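(* Let $M$ be a nonempty smooth manifold of positive dimension and let $(M,F,g)$ be an $(\alpha,\varepsilon)$-metric manifold with $\alpha=+1$. Then the generalized almost complex structure $$\mathcal J_{F,g}=\begin{pmatrix}F&-\sqrt2\,\sharp_g\\ \sqrt2\,\flat_g&-\varepsilon F^*\end{pmatrix}$$ on $\mathbb TM=TM\oplus T^*M$ is compatible with the natural generalized metric $\mathcal G_0$ if and only if $\varepsilon=-1$, that is, if and only if $(M,F,g)$ is an almost para-Hermitian manifold. In this case, $(\mathcal J_{F,g},\mathcal G_0)$ is a generalized almost Norden structure, with twin metric $$\Phi_{\mathcal J_{F,g}}(X+\xi,Y+\eta)=\mathcal G_0(FX+\xi,FY+\eta)+\tfrac{\sqrt2}{2}\big(g(X,Y)-g(\sharp_g\xi,\sharp_g\eta)\big)$$ for all $X,Y\in\mathfrak X(M)$, $\xi,\eta\in\Lambda^1(M)$.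
   Context: An $(\alpha,\varepsilon)$-metric manifold $(M,F,g)$, $\alpha,\varepsilon\in\{+1,-1\}$, is a smooth manifold with a Riemannian or pseudo-Riemannian (i.e. nondegenerate, not positive definite) metric $g$ and an $\mathfrak F(M)$-linear $F\colon\mathfrak X(M)\to\mathfrak X(M)$ with $F^2=\alpha Id$ and $g(FX,FY)=\varepsilon g(X,Y)$ for all $X,Y$. For $\alpha=+1,\varepsilon=-1$ it is called almost para-Hermitian. $\mathfrak F(M)$, $\mathfrak X(M)$, $\Lambda^1(M)$ denote smooth functions, vector fields, 1-forms; sections of $\mathbb TM$ are written $X+\xi$. $(\flat_gX)(Y)=g(X,Y)$, $\sharp_g=\flat_g^{-1}$, $(F^*\xi)(X)=\xi(FX)$. Matrix notation: $\begin{pmatrix}H&\sigma\\ \tau&K\end{pmatrix}(X+\xi)=(HX+\sigma\xi)+(\tau X+K\xi)$. A generalized almost complex structure is an $\mathfrak F(M)$-linear endomorphism $\mathcal J$ of $\Gamma(\mathbb TM)$ with $\mathcal J^2=-Id$. $\mathcal G_0(X+\xi,Y+\eta)=\frac12(\xi(Y)+\eta(X))$. An endomorphism $\mathcal K$ is compatible with a metric $\mathcal G$ on $\mathbb TM$ if there is $\delta\in\{+1,-1\}$ with $\mathcal G(\mathcal Ku,\mathcal Kv)=\delta\,\mathcal G(u,v)$ for all sections $u,v$. $(\mathcal J,\mathcal G)$ with $\mathcal J^2=-Id$ is generalized almost Norden if $\mathcal G(\mathcal Ju,\mathcal Jv)=-\mathcal G(u,v)$ for all $u,v$; its twin metric is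 $\Phi_{\mathcal J}(u,v)=\mathcal G(\mathcal Ju,v)$. *)

theory Defs
  imports "HOL-Analysis.Analysis"
begin

section \<open>Smooth maps between Euclidean spaces\<close>

text \<open>To be used on open sets \<open>S\<close>: the derivatives are full derivatives, and a map is of class
  \<open>C^(k+1)\<close> if it is differentiable and all its directional derivatives are of class \<open>C^k\<close>.\<close>

primrec Ck_on :: "nat \<Rightarrow> 'a::euclidean_space set \<Rightarrow> ('a \<Rightarrow> 'b::real_normed_vector) \<Rightarrow> bool" where
  "Ck_on 0 S f \<longleftrightarrow> continuous_on S f"
| "Ck_on (Suc k) S f \<longleftrightarrow>
     (\<forall>x\<in>S. f differentiable (at x)) \<and>
     (\<forall>v. Ck_on k S (\<lambda>x. frechet_derivative f (at x) v))"

definition smooth_on :: "'a::euclidean_space set \<Rightarrow> ('a \<Rightarrow> 'b::real_normed_vector) \<Rightarrow> bool" where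
  "smooth_on S f \<longleftrightarrow> (\<forall>k. Ck_on k S f)"


section \<open>Smooth manifolds\<close>

text \<open>A chart is a pair of its domain and its coordinate map into the model space \<open>'e\<close>; only the
  values of the coordinate map on the domain matter. The dimension of the manifold is \<open>DIM('e)\<close>,
  which is positive for every type of class \<open>euclidean_space\<close>.\<close>

type_synonym ('m, 'e) chart = "'m set \<times> ('m \<Rightarrow> 'e)"

record ('m, 'e) mfd =
  mtop :: "'m topology"
  atlas :: "('m, 'e) chart set"

abbreviation points :: "('m, 'e) mfd \<Rightarrow> 'm set" where
  "points M \<equiv> topspace (mtop M)"

definition cimage :: "('m, 'e) chart \<Rightarrow> 'e set" where
  "cimage c = snd c ` fst c"

definition cinv :: "('m, 'e) chart \<Rightarrow> 'e \<Rightarrow> 'm" where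
  "cinv c = inv_into (fst c) (snd c)"

definition transition :: "('m, 'e) chart \<Rightarrow> ('m, 'e) chart \<Rightarrow> 'e \<Rightarrow> 'e" where
  "transition c d = snd d \<circ> cinv c"

definition is_chart :: "'m topology \<Rightarrow> ('m, 'e::euclidean_space) chart \<Rightarrow> bool" where
  "is_chart T c \<longleftrightarrow> openin T (fst c) \<and> open (cimage c) \<and>
     homeomorphic_map (subtopology T (fst c)) (top_of_set (cimage c)) (snd c)"

definition smooth_manifold :: "('m, 'e::euclidean_space) mfd \<Rightarrow> bool" where
  "smooth_manifold M \<longleftrightarrow>
     Hausdorff_space (mtop M) \<and> second_countable (mtop M) \<and>
     (\<forall>c\<in>atlas M. is_chart (mtop M) c) \<and>
     (\<Union>c\<in>atlas M. fst c) = points M \<and>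
     (\<forall>c\<in>atlas M. \<forall>d\<in>atlas M. smooth_on (snd c ` (fst c \<inter> fst d)) (transition c d))"

definition charts_at :: "('m, 'e) mfd \<Rightarrow> 'm \<Rightarrow> ('m, 'e) chart set" where
  "charts_at M p = {c \<in> atlas M. p \<in> fst c}"

text \<open>Functions and sections are total in HOL; they are normalized to vanish off the manifold, so
  that equality of functions is equality on the manifold.\<close>

definition smooth_functions :: "('m, 'e::euclidean_space) mfd \<Rightarrow> ('m \<Rightarrow> real) set" where
  "smooth_functions M = {f. (\<forall>p. p \<notin> points M \<longrightarrow> f p = 0) \<and>
     (\<forall>c\<in>atlas M. smooth_on (cimage c) (f \<circ> cinv c))}"


section \<open>Tangent and cotangent vectors, vector fields and 1-forms\<close>

text \<open>A tangent vector at \<open>p\<close> is the family of its coordinate representations in all charts around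
  \<open>p\<close>, related by the derivatives of the transition maps.\<close>

type_synonym ('m, 'e) tvec = "('m, 'e) chart \<Rightarrow> 'e"

definition tangent_space :: "('m, 'e::euclidean_space) mfd \<Rightarrow> 'm \<Rightarrow> ('m, 'e) tvec set" where
  "tangent_space M p = {v. (\<forall>c. c \<notin> charts_at M p \<longrightarrow> v c = 0) \<and>
     (\<forall>c\<in>charts_at M p. \<forall>d\<in>charts_at M p.
        v d = frechet_derivative (transition c d) (at (snd c p)) (v c))}"

text \<open>The tangent vector at \<open>p\<close> whose representation in the chart \<open>c\<close> is \<open>e\<close>; for \<open>e\<close> in the
  standard basis these are the coordinate vectors of the chart.\<close>

definition coord_vec ::
  "('m, 'e::euclidean_space) mfd \<Rightarrow> ('m, 'e) chart \<Rightarrow> 'e \<Rightarrow> 'm \<Rightarrow> ('m, 'e) tvec" where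
  "coord_vec M c e p = (\<lambda>d. if d \<in> charts_at M p
     then frechet_derivative (transition c d) (at (snd c p)) e else 0)"

definition linear_functional_on ::
  "('k \<Rightarrow> 'b::real_vector) set \<Rightarrow> (('k \<Rightarrow> 'b) \<Rightarrow> real) \<Rightarrow> bool" where
  "linear_functional_on V l \<longleftrightarrow>
     (\<forall>v\<in>V. \<forall>w\<in>V. l (\<lambda>k. v k + w k) = l v + l w) \<and>
     (\<forall>a. \<forall>v\<in>V. l (\<lambda>k. a *\<^sub>R v k) = a * l v)"

definition cotangent_space ::
  "('m, 'e::euclidean_space) mfd \<Rightarrow> 'm \<Rightarrow> (('m, 'e) tvec \<Rightarrow> real) set" where
  "cotangent_space M p = {l. linear_functional_on (tangent_space M p) l \<and>
     (\<forall>v. v \<notin> tangent_space M p \<longrightarrow> l v = 0)}"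

type_synonym ('m, 'e) vfield = "'m \<Rightarrow> ('m, 'e) tvec"
type_synonym ('m, 'e) form1 = "'m \<Rightarrow> ('m, 'e) tvec \<Rightarrow> real"

definition vector_fields :: "('m, 'e::euclidean_space) mfd \<Rightarrow> ('m, 'e) vfield set" where
  "vector_fields M = {X. (\<forall>p\<in>points M. X p \<in> tangent_space M p) \<and>
     (\<forall>p. p \<notin> points M \<longrightarrow> X p = (\<lambda>_. 0)) \<and>
     (\<forall>c\<in>atlas M. smooth_on (cimage c) (\<lambda>x. X (cinv c x) c))}"

definition one_forms :: "('m, 'e::euclidean_space) mfd \<Rightarrow> ('m, 'e) form1 set" where
  "one_forms M = {\<xi>. (\<forall>p\<in>points M. \<xi> p \<in> cotangent_space M p) \<and>
     (\<forall>p. p \<notin> points M \<longrightarrow> \<xi> p = (\<lambda>_. 0)) \<and>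
     (\<forall>c\<in>atlas M. \<forall>e. smooth_on (cimage c) (\<lambda>x. \<xi> (cinv c x) (coord_vec M c e (cinv c x))))}"

text \<open>Pointwise operations, shared by vector fields and 1-forms.\<close>

definition sec_add :: "('m \<Rightarrow> 'k \<Rightarrow> 'b::real_vector) \<Rightarrow> ('m \<Rightarrow> 'k \<Rightarrow> 'b) \<Rightarrow> 'm \<Rightarrow> 'k \<Rightarrow> 'b" where
  "sec_add X Y = (\<lambda>p k. X p k + Y p k)"

definition sec_scale :: "('m \<Rightarrow> real) \<Rightarrow> ('m \<Rightarrow> 'k \<Rightarrow> 'b::real_vector) \<Rightarrow> 'm \<Rightarrow> 'k \<Rightarrow> 'b" where
  "sec_scale f X = (\<lambda>p k. f p *\<^sub>R X p k)"

definition module_endomorphism :: "('m, 'e::euclidean_space) mfd \<Rightarrow> 's set \<Rightarrow>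
    ('s \<Rightarrow> 's \<Rightarrow> 's) \<Rightarrow> (('m \<Rightarrow> real) \<Rightarrow> 's \<Rightarrow> 's) \<Rightarrow> ('s \<Rightarrow> 's) \<Rightarrow> bool" where
  "module_endomorphism M V ad sm L \<longleftrightarrow>
     (\<forall>u\<in>V. L u \<in> V) \<and>
     (\<forall>u\<in>V. \<forall>v\<in>V. L (ad u v) = ad (L u) (L v)) \<and>
     (\<forall>f\<in>smooth_functions M. \<forall>u\<in>V. L (sm f u) = sm f (L u))"


section \<open>Metrics and \<open>(\<alpha>,\<epsilon>)\<close>-metric manifolds\<close>

type_synonym ('m, 'e) tensor2 = "'m \<Rightarrow> ('m, 'e) tvec \<Rightarrow> ('m, 'e) tvec \<Rightarrow> real"

definition symmetric_2tensor :: "('m, 'e::euclidean_space) mfd \<Rightarrow> ('m, 'e) tensor2 \<Rightarrow> bool" where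
  "symmetric_2tensor M g \<longleftrightarrow>
     (\<forall>p\<in>points M.
        (\<forall>v\<in>tangent_space M p. linear_functional_on (tangent_space M p) (g p v)) \<and>
        (\<forall>v\<in>tangent_space M p. \<forall>w\<in>tangent_space M p. g p v w = g p w v)) \<and>
     (\<forall>c\<in>atlas M. \<forall>e e'. smooth_on (cimage c)
        (\<lambda>x. g (cinv c x) (coord_vec M c e (cinv c x)) (coord_vec M c e' (cinv c x))))"

definition nondegenerate :: "('m, 'e::euclidean_space) mfd \<Rightarrow> ('m, 'e) tensor2 \<Rightarrow> bool" where
  "nondegenerate M g \<longleftrightarrow> (\<forall>p\<in>points M. \<forall>v\<in>tangent_space M p.
     (\<forall>w\<in>tangent_space M p. g p v w = 0) \<longrightarrow> v = (\<lambda>_. 0))"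

definition positive_definite :: "('m, 'e::euclidean_space) mfd \<Rightarrow> ('m, 'e) tensor2 \<Rightarrow> bool" where
  "positive_definite M g \<longleftrightarrow> (\<forall>p\<in>points M. \<forall>v\<in>tangent_space M p.
     v \<noteq> (\<lambda>_. 0) \<longrightarrow> g p v v > 0)"

definition riemannian_metric :: "('m, 'e::euclidean_space) mfd \<Rightarrow> ('m, 'e) tensor2 \<Rightarrow> bool" where
  "riemannian_metric M g \<longleftrightarrow> symmetric_2tensor M g \<and> positive_definite M g"

definition pseudo_riemannian_metric ::
  "('m, 'e::euclidean_space) mfd \<Rightarrow> ('m, 'e) tensor2 \<Rightarrow> bool" where
  "pseudo_riemannian_metric M g \<longleftrightarrow>
     symmetric_2tensor M g \<and> nondegenerate M g \<and> \<not> positive_definite M g"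

definition metric_manifold :: "real \<Rightarrow> real \<Rightarrow> ('m, 'e::euclidean_space) mfd \<Rightarrow>
    (('m, 'e) vfield \<Rightarrow> ('m, 'e) vfield) \<Rightarrow> ('m, 'e) tensor2 \<Rightarrow> bool" where
  "metric_manifold \<alpha> \<epsilon> M F g \<longleftrightarrow>
     \<alpha> \<in> {1, -1} \<and> \<epsilon> \<in> {1, -1} \<and>
     smooth_manifold M \<and>
     (riemannian_metric M g \<or> pseudo_riemannian_metric M g) \<and>
     module_endomorphism M (vector_fields M) sec_add sec_scale F \<and>
     (\<forall>X\<in>vector_fields M. F (F X) = sec_scale (\<lambda>_. \<alpha>) X) \<and>
     (\<forall>X\<in>vector_fields M. \<forall>Y\<in>vector_fields M. \<forall>p\<in>points M.
        g p (F X p) (F Y p) = \<epsilon> * g p (X p) (Y p))"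

definition almost_para_hermitian :: "('m, 'e::euclidean_space) mfd \<Rightarrow>
    (('m, 'e) vfield \<Rightarrow> ('m, 'e) vfield) \<Rightarrow> ('m, 'e) tensor2 \<Rightarrow> bool" where
  "almost_para_hermitian M F g \<longleftrightarrow> metric_manifold 1 (-1) M F g"

definition flat :: "('m, 'e::euclidean_space) mfd \<Rightarrow> ('m, 'e) tensor2 \<Rightarrow>
    ('m, 'e) vfield \<Rightarrow> ('m, 'e) form1" where
  "flat M g X = (\<lambda>p v. if p \<in> points M \<and> v \<in> tangent_space M p then g p (X p) v else 0)"

definition sharp :: "('m, 'e::euclidean_space) mfd \<Rightarrow> ('m, 'e) tensor2 \<Rightarrow>
    ('m, 'e) form1 \<Rightarrow> ('m, 'e) vfield" where
  "sharp M g = the_inv_into (vector_fields M) (flat M g)"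

text \<open>The 1-form \<open>F\<^sup>*\<xi>\<close> is determined by its values \<open>\<xi>(FX)\<close> on vector fields \<open>X\<close>.\<close>

definition dual_endo :: "('m, 'e::euclidean_space) mfd \<Rightarrow>
    (('m, 'e) vfield \<Rightarrow> ('m, 'e) vfield) \<Rightarrow> ('m, 'e) form1 \<Rightarrow> ('m, 'e) form1" where
  "dual_endo M F \<xi> = (THE \<zeta>. \<zeta> \<in> one_forms M \<and>
     (\<forall>X\<in>vector_fields M. \<forall>p\<in>points M. \<zeta> p (X p) = \<xi> p (F X p)))"


section \<open>Structures on the generalized tangent bundle\<close>

text \<open>A section \<open>X + \<xi>\<close> of \<open>TM \<oplus> T\<^sup>*M\<close> is the pair \<open>(X, \<xi>)\<close>.\<close>

type_synonym ('m, 'e) gsec = "('m, 'e) vfield \<times> ('m, 'e) form1"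

definition gsections :: "('m, 'e::euclidean_space) mfd \<Rightarrow> ('m, 'e) gsec set" where
  "gsections M = vector_fields M \<times> one_forms M"

definition gadd :: "('m, 'e::euclidean_space) gsec \<Rightarrow> ('m, 'e) gsec \<Rightarrow> ('m, 'e) gsec" where
  "gadd u v = (sec_add (fst u) (fst v), sec_add (snd u) (snd v))"

definition gscale :: "('m \<Rightarrow> real) \<Rightarrow> ('m, 'e::euclidean_space) gsec \<Rightarrow> ('m, 'e) gsec" where
  "gscale f u = (sec_scale f (fst u), sec_scale f (snd u))"

definition block_endo ::
  "(('m, 'e::euclidean_space) vfield \<Rightarrow> ('m, 'e) vfield) \<Rightarrow> (('m, 'e) form1 \<Rightarrow> ('m, 'e) vfield) \<Rightarrow>
   (('m, 'e) vfield \<Rightarrow> ('m, 'e) form1) \<Rightarrow> (('m, 'e) form1 \<Rightarrow> ('m, 'e) form1) \<Rightarrow>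
   ('m, 'e) gsec \<Rightarrow> ('m, 'e) gsec" where
  "block_endo H \<sigma> \<tau> K = (\<lambda>(X, \<xi>). (sec_add (H X) (\<sigma> \<xi>), sec_add (\<tau> X) (K \<xi>)))"

definition gen_almost_complex ::
  "('m, 'e::euclidean_space) mfd \<Rightarrow> (('m, 'e) gsec \<Rightarrow> ('m, 'e) gsec) \<Rightarrow> bool" where
  "gen_almost_complex M J \<longleftrightarrow>
     module_endomorphism M (gsections M) gadd gscale J \<and>
     (\<forall>u\<in>gsections M. J (J u) = gscale (\<lambda>_. -1) u)"

type_synonym ('m, 'e) gform = "('m, 'e) gsec \<Rightarrow> ('m, 'e) gsec \<Rightarrow> 'm \<Rightarrow> real"

definition gen_metric :: "('m, 'e::euclidean_space) mfd \<Rightarrow> ('m, 'e) gform \<Rightarrow> bool" where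
  "gen_metric M G \<longleftrightarrow>
     (\<forall>u\<in>gsections M. \<forall>v\<in>gsections M. G u v \<in> smooth_functions M \<and> G u v = G v u) \<and>
     (\<forall>u\<in>gsections M. \<forall>v\<in>gsections M. \<forall>w\<in>gsections M.
        G (gadd u v) w = (\<lambda>p. G u w p + G v w p)) \<and>
     (\<forall>f\<in>smooth_functions M. \<forall>u\<in>gsections M. \<forall>v\<in>gsections M.
        G (gscale f u) v = (\<lambda>p. f p * G u v p)) \<and>
     (\<forall>p\<in>points M. \<forall>u\<in>gsections M. (\<forall>v\<in>gsections M. G u v p = 0) \<longrightarrow>
        fst u p = (\<lambda>_. 0) \<and> snd u p = (\<lambda>_. 0))"

definition natural_metric :: "('m, 'e::euclidean_space) gform" where
  "natural_metric u v = (\<lambda>p. 1/2 * (snd u p (fst v p) + snd v p (fst u p)))"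

definition compatible :: "('m, 'e::euclidean_space) mfd \<Rightarrow>
    (('m, 'e) gsec \<Rightarrow> ('m, 'e) gsec) \<Rightarrow> ('m, 'e) gform \<Rightarrow> bool" where
  "compatible M K G \<longleftrightarrow> (\<exists>\<delta>\<in>{1, -1}. \<forall>u\<in>gsections M. \<forall>v\<in>gsections M. \<forall>p\<in>points M.
     G (K u) (K v) p = \<delta> * G u v p)"

definition gen_almost_norden :: "('m, 'e::euclidean_space) mfd \<Rightarrow>
    (('m, 'e) gsec \<Rightarrow> ('m, 'e) gsec) \<Rightarrow> ('m, 'e) gform \<Rightarrow> bool" where
  "gen_almost_norden M J G \<longleftrightarrow> gen_almost_complex M J \<and> gen_metric M G \<and>
     (\<forall>u\<in>gsections M. \<forall>v\<in>gsections M. \<forall>p\<in>points M. G (J u) (J v) p = - G u v p)"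

definition twin_metric ::
  "(('m, 'e::euclidean_space) gsec \<Rightarrow> ('m, 'e) gsec) \<Rightarrow> ('m, 'e) gform \<Rightarrow> ('m, 'e) gform" where
  "twin_metric J G u v = G (J u) v"

definition J_Fg :: "('m, 'e::euclidean_space) mfd \<Rightarrow> real \<Rightarrow>
    (('m, 'e) vfield \<Rightarrow> ('m, 'e) vfield) \<Rightarrow> ('m, 'e) tensor2 \<Rightarrow> ('m, 'e) gsec \<Rightarrow> ('m, 'e) gsec" where
  "J_Fg M \<epsilon> F g = block_endo
     F (\<lambda>\<xi>. sec_scale (\<lambda>_. - sqrt 2) (sharp M g \<xi>))
     (\<lambda>X. sec_scale (\<lambda>_. sqrt 2) (flat M g X)) (\<lambda>\<xi>. sec_scale (\<lambda>_. - \<epsilon>) (dual_endo M F \<xi>))"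

end

theory Submission
  imports Defs
begin

text \<open>Since \<open>F\<close> is given on global sections only, bump functions are used to show that it is a tensor,
  which makes \<open>F\<^sup>*\<close> a well-defined operator on smooth 1-forms; nondegeneracy makes \<open>\<flat>\<close> bijective, with smooth
  inverse. Since \<open>F\<^sup>2 = Id\<close>, the compatibility of \<open>F\<close> and \<open>g\<close> reads \<open>g(FX, Y) = \<epsilon> g(X, FY)\<close>, that is,
  \<open>F\<^sup>* \<flat> = \<epsilon> \<flat> F\<close>, and this gives \<open>J\<^sup>2 = -Id\<close>. In \<open>G\<^sub>0(Ju, Jv)\<close> the terms mixing \<open>u\<close> and \<open>v\<close> through \<open>g\<close>
  carry the factor \<open>1 + \<epsilon>\<close>, and the rest is \<open>-(2 + \<epsilon>) G\<^sub>0(u, v)\<close>; hence \<open>\<epsilon> = -1\<close> yields \<open>-G\<^sub>0(u, v)\<close>, while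
  pairing a vector field with a 1-form shows that \<open>\<epsilon> = 1\<close>, with the factor \<open>-3\<close>, is incompatible.\<close>

section \<open>Calculus of smooth maps\<close>

text \<open>The constant \<open>sqrt 2\<close> is tuned to alpha = 1: the musical blocks multiply to
  -2 Id, so the diagonal blocks of the square of \<open>J_Fg\<close> are Id - 2 Id = -Id. The factor
  \<open>- \<epsilon>\<close> in the lower corner is what lets the off-diagonal blocks cancel. The
  obstacle is that \<open>sharp\<close> is an inverse on global sections and
  \<open>dual_endo\<close> a definite description: neither can be computed with until a smooth
  object with the defining property has been exhibited. Pointwise candidates are easy to choose, but
  a choice made point by point carries no smoothness. In both cases the local components of the
  candidate solve a linear system with smooth coefficients: the Gram system of \<open>g\<close> for
  \<open>sharp\<close>, and a scalar equation with a bump function as coefficient for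
  \<open>dual_endo\<close>. The analytic core is therefore the smooth dependence of such solutions
  on the coefficients.\<close>

lemma frechet_derivative_eqI:
  "(f has_derivative f') (at x) \<Longrightarrow> frechet_derivative f (at x) = f'"
  by (metis frechet_derivative_at)

text \<open>On an open set the full derivative at a point depends only on values inside the set, so
  agreement on \<open>S\<close> passes to all iterated derivatives.\<close>

lemma Ck_on_cong:
  assumes "open S" "\<And>x. x \<in> S \<Longrightarrow> f x = g x"
  shows "Ck_on k S f \<longleftrightarrow> Ck_on k S g"
proof -
  have *: "Ck_on k S g" if "Ck_on k S f" "\<And>x. x \<in> S \<Longrightarrow> f x = g x" for f g :: "'a \<Rightarrow> 'b"
    using that
  proof (induction k arbitrary: f g)
    case 0
    then show ?case
      using continuous_on_cong by (metis Ck_on.simps(1))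
  next
    case (Suc k)
    have d: "(g has_derivative frechet_derivative f (at x)) (at x)" if "x \<in> S" for x
    proof -
      have "(f has_derivative frechet_derivative f (at x)) (at x)"
        using Suc.prems(1) that by (simp add: frechet_derivative_works)
      then show ?thesis
        using has_derivative_transform_within_open[OF _ assms(1) that] Suc.prems(2) by blast
    qed
    have "Ck_on k S (\<lambda>x. frechet_derivative g (at x) v)" for v
    proof (rule Suc.IH)
      show "Ck_on k S (\<lambda>x. frechet_derivative f (at x) v)"
        using Suc.prems(1) by simp
      show "frechet_derivative f (at x) v = frechet_derivative g (at x) v" if "x \<in> S" for x
        using frechet_derivative_eqI[OF d[OF that]] by simp
    qed
    then show ?case
      using d by (auto simp: differentiable_def)
  qed
  show ?thesis
    using *[of f g] *[of g f] assms(2) by auto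
qed

text \<open>The working form of the recursion: the derivative may be given by any explicit formula
  valid on \<open>S\<close>, so later inductions never compute \<open>frechet_derivative\<close>
  itself.\<close>

lemma Ck_on_SucI:
  assumes "open S" "\<And>x. x \<in> S \<Longrightarrow> (f has_derivative f' x) (at x)"
    "\<And>v. Ck_on k S (\<lambda>x. f' x v)"
  shows "Ck_on (Suc k) S f"
proof -
  have "Ck_on k S (\<lambda>x. frechet_derivative f (at x) v)" for v
    using Ck_on_cong[OF assms(1), of "\<lambda>x. f' x v" "\<lambda>x. frechet_derivative f (at x) v" k]
      assms(3) frechet_derivative_eqI[OF assms(2)] by simp
  then show ?thesis
    using assms(2) by (auto simp: differentiable_def)
qed

lemma Ck_on_has_derivative:
  "Ck_on (Suc k) S f \<Longrightarrow> x \<in> S \<Longrightarrow> (f has_derivative frechet_derivative f (at x)) (at x)"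
  by (simp add: frechet_derivative_works)

lemma Ck_on_SucD: "Ck_on (Suc k) S f \<Longrightarrow> Ck_on k S f"
proof (induction k arbitrary: f)
  case 0
  then show ?case
    by (auto simp: continuous_at_imp_continuous_on differentiable_imp_continuous_within)
next
  case (Suc k)
  then show ?case
    by (metis Ck_on.simps(2))
qed

lemma Ck_on_subset: "Ck_on k S f \<Longrightarrow> T \<subseteq> S \<Longrightarrow> Ck_on k T f"
  by (induction k arbitrary: f) (auto intro: continuous_on_subset)

text \<open>Differentiability is a pointwise condition, and continuity glues over open sets, so the
  class is local.\<close>

lemma Ck_on_open_Union: "(\<And>T. T \<in> \<T> \<Longrightarrow> open T \<and> Ck_on k T f) \<Longrightarrow> Ck_on k (\<Union>\<T>) f"
proof (induction k arbitrary: f)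
  case 0
  then show ?case
    by (auto intro: continuous_on_open_Union)
qed auto

lemma Ck_on_const: "Ck_on k S (\<lambda>_. c)"
  by (induction k arbitrary: c) (simp_all add: frechet_derivative_const)

lemma Ck_on_bounded_linear:
  assumes "bounded_linear L" "open S" "Ck_on k S f"
  shows "Ck_on k S (\<lambda>x. L (f x))"
  using assms(3)
proof (induction k arbitrary: f)
  case 0
  then show ?case
    using assms(1) bounded_linear.continuous_on by auto
next
  case (Suc k)
  show ?case
    by (rule Ck_on_SucI[OF assms(2)
          bounded_linear.has_derivative[OF assms(1) Ck_on_has_derivative[OF Suc.prems]]])
      (use Suc in simp_all)
qed

lemma Ck_on_add:
  assumes "open S" "Ck_on k S f" "Ck_on k S g"
  shows "Ck_on k S (\<lambda>x. f x + g x)"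
  using assms(2,3)
proof (induction k arbitrary: f g)
  case 0
  then show ?case
    by (auto intro: continuous_intros)
next
  case (Suc k)
  show ?case
    by (rule Ck_on_SucI[OF assms(1) has_derivative_add[OF
          Ck_on_has_derivative[OF Suc.prems(1)] Ck_on_has_derivative[OF Suc.prems(2)]]])
      (use Suc in simp_all)
qed

lemma Ck_on_sum:
  assumes "open S" "\<And>i. i \<in> I \<Longrightarrow> Ck_on k S (f i)"
  shows "Ck_on k S (\<lambda>x. \<Sum>i\<in>I. f i x)"
  using assms(2)
  by (induction I rule: infinite_finite_induct) (auto intro: Ck_on_const Ck_on_add assms(1))

text \<open>The product rule yields two terms of the same bilinear shape, each pairing a derivative
  with an undifferentiated factor; the latter is lowered from class k+1 to class k for the
  induction.\<close>

lemma Ck_on_bounded_bilinear: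
  assumes "bounded_bilinear B" "open S" "Ck_on k S f" "Ck_on k S g"
  shows "Ck_on k S (\<lambda>x. B (f x) (g x))"
  using assms(3,4)
proof (induction k arbitrary: f g)
  case 0
  then show ?case
    using bounded_bilinear.continuous_on[OF assms(1)] by auto
next
  case (Suc k)
  show ?case
  proof (rule Ck_on_SucI[OF assms(2) bounded_bilinear.FDERIV[OF assms(1)
          Ck_on_has_derivative[OF Suc.prems(1)] Ck_on_has_derivative[OF Suc.prems(2)]]])
    show "Ck_on k S (\<lambda>x. B (f x) (frechet_derivative g (at x) v) +
        B (frechet_derivative f (at x) v) (g x))" for v
      using Suc.prems by (intro Ck_on_add assms(2) Suc.IH) (auto intro: Ck_on_SucD)
  qed
qed

lemma linear_on_Basis:
  fixes L :: "'b::euclidean_space \<Rightarrow> 'c::real_vector"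
  assumes "linear L"
  shows "L w = (\<Sum>i\<in>Basis. (w \<bullet> i) *\<^sub>R L i)"
proof -
  have "L (\<Sum>i\<in>Basis. (w \<bullet> i) *\<^sub>R i) = (\<Sum>i\<in>Basis. (w \<bullet> i) *\<^sub>R L i)"
    using assms by (simp add: linear_sum linear_scale)
  then show ?thesis
    by (simp add: euclidean_representation)
qed

text \<open>In the chain rule the derivative of \<open>g\<close> is applied to a direction that
  varies with the point, whereas the induction hypothesis covers fixed directions only. Expanding in
  the basis separates the two dependences into products.\<close>

lemma Ck_on_compose:
  assumes "open S" "open T" "f ` S \<subseteq> T" "Ck_on k S f" "Ck_on k T g"
  shows "Ck_on k S (\<lambda>x. g (f x))"
  using assms(4,5)
proof (induction k arbitrary: g)
  case 0
  then show ?case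
    using continuous_on_compose2 assms(3) by (metis Ck_on.simps(1))
next
  case (Suc k)
  show ?case
  proof (rule Ck_on_SucI[OF assms(1)])
    let ?f' = "\<lambda>x. frechet_derivative f (at x)" and ?g' = "\<lambda>x. frechet_derivative g (at x)"
    show "((\<lambda>x. g (f x)) has_derivative (\<lambda>v. \<Sum>i\<in>Basis. (?f' x v \<bullet> i) *\<^sub>R ?g' (f x) i)) (at x)"
      if x: "x \<in> S" for x
    proof -
      have g': "(g has_derivative ?g' (f x)) (at (f x))"
        using Ck_on_has_derivative[OF Suc.prems(2)] x assms(3) by blast
      have "?g' (f x) \<circ> ?f' x = (\<lambda>v. \<Sum>i\<in>Basis. (?f' x v \<bullet> i) *\<^sub>R ?g' (f x) i)"
        unfolding o_def by (rule ext, rule linear_on_Basis[OF has_derivative_linear[OF g']])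
      then show ?thesis
        using diff_chain_at[OF Ck_on_has_derivative[OF Suc.prems(1) x] g'] by (simp add: o_def)
    qed
    show "Ck_on k S (\<lambda>x. \<Sum>i\<in>Basis. (?f' x v \<bullet> i) *\<^sub>R ?g' (f x) i)" for v
      using Suc.prems
      by (intro Ck_on_sum assms(1) Ck_on_bounded_bilinear[OF bounded_bilinear_scaleR]
          Ck_on_bounded_linear[OF bounded_linear_inner_left] Suc.IH) (auto intro: Ck_on_SucD)
  qed
qed

lemma smooth_on_cong:
  "open S \<Longrightarrow> (\<And>x. x \<in> S \<Longrightarrow> f x = g x) \<Longrightarrow> smooth_on S f \<longleftrightarrow> smooth_on S g"
  using Ck_on_cong unfolding smooth_on_def by metis

lemma smooth_on_transform:
  "smooth_on S f \<Longrightarrow> open S \<Longrightarrow> (\<And>x. x \<in> S \<Longrightarrow> f x = g x) \<Longrightarrow> smooth_on S g"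
  using smooth_on_cong by blast

lemma smooth_on_subset: "smooth_on S f \<Longrightarrow> T \<subseteq> S \<Longrightarrow> smooth_on T f"
  using Ck_on_subset unfolding smooth_on_def by blast

lemma smooth_on_open_Un:
  assumes "open S" "open T" "smooth_on S f" "smooth_on T f"
  shows "smooth_on (S \<union> T) f"
  using assms Ck_on_open_Union[of "{S, T}"] unfolding smooth_on_def by fastforce

lemma smooth_on_open_cover:
  assumes "\<And>x. x \<in> S \<Longrightarrow> \<exists>T. open T \<and> x \<in> T \<and> T \<subseteq> S \<and> smooth_on T f"
  shows "smooth_on S f"
  unfolding smooth_on_def
proof
  fix k
  let ?T = "{T. open T \<and> T \<subseteq> S \<and> smooth_on T f}"
  have "Ck_on k (\<Union>?T) f"
    by (rule Ck_on_open_Union) (auto simp: smooth_on_def)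
  moreover have "\<Union>?T = S"
    using assms by blast
  ultimately show "Ck_on k S f"
    by simp
qed

lemma smooth_on_const: "smooth_on S (\<lambda>_. c)"
  by (simp add: smooth_on_def Ck_on_const)

lemma smooth_on_id: "open S \<Longrightarrow> smooth_on S (\<lambda>x. x)"
proof -
  assume "open S"
  have "Ck_on k S (\<lambda>x. x)" for k
  proof (cases k)
    case (Suc k')
    show ?thesis
      unfolding Suc by (rule Ck_on_SucI[OF \<open>open S\<close> has_derivative_ident Ck_on_const])
  qed simp
  then show ?thesis
    by (simp add: smooth_on_def)
qed

lemma smooth_on_add:
  "open S \<Longrightarrow> smooth_on S f \<Longrightarrow> smooth_on S g \<Longrightarrow> smooth_on S (\<lambda>x. f x + g x)"
  by (simp add: smooth_on_def Ck_on_add)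

lemma smooth_on_sum:
  "open S \<Longrightarrow> (\<And>i. i \<in> I \<Longrightarrow> smooth_on S (f i)) \<Longrightarrow> smooth_on S (\<lambda>x. \<Sum>i\<in>I. f i x)"
  by (simp add: smooth_on_def Ck_on_sum)

lemma smooth_on_scaleR:
  "open S \<Longrightarrow> smooth_on S f \<Longrightarrow> smooth_on S g \<Longrightarrow> smooth_on S (\<lambda>x. f x *\<^sub>R g x)"
  by (simp add: smooth_on_def Ck_on_bounded_bilinear[OF bounded_bilinear_scaleR])

lemma smooth_on_mult:
  fixes f g :: "'a::euclidean_space \<Rightarrow> real"
  shows "open S \<Longrightarrow> smooth_on S f \<Longrightarrow> smooth_on S g \<Longrightarrow> smooth_on S (\<lambda>x. f x * g x)"
  using smooth_on_scaleR[of S f g] by simp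

lemma smooth_on_inner:
  "open S \<Longrightarrow> smooth_on S f \<Longrightarrow> smooth_on S g \<Longrightarrow> smooth_on S (\<lambda>x. f x \<bullet> g x)"
  by (simp add: smooth_on_def Ck_on_bounded_bilinear[OF bounded_bilinear_inner])

lemma smooth_on_compose:
  "open S \<Longrightarrow> open T \<Longrightarrow> f ` S \<subseteq> T \<Longrightarrow> smooth_on S f \<Longrightarrow> smooth_on T g \<Longrightarrow>
    smooth_on S (\<lambda>x. g (f x))"
  unfolding smooth_on_def by (blast intro: Ck_on_compose)

lemma smooth_on_frechet_derivative:
  "smooth_on S f \<Longrightarrow> smooth_on S (\<lambda>x. frechet_derivative f (at x) v)"
  unfolding smooth_on_def by (metis Ck_on.simps(2))

lemma smooth_on_has_derivative:
  "smooth_on S f \<Longrightarrow> x \<in> S \<Longrightarrow> (f has_derivative frechet_derivative f (at x)) (at x)"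
  unfolding smooth_on_def by (blast intro: Ck_on_has_derivative)

section \<open>Linear systems depending on a parameter\<close>

lemma norm_linear_diff_le:
  fixes L L' :: "'b::euclidean_space \<Rightarrow> 'c::real_normed_vector"
  assumes "linear L" "linear L'"
  shows "norm (L w - L' w) \<le> (\<Sum>i\<in>Basis. norm (L i - L' i)) * norm w"
proof -
  have "L w - L' w = (\<Sum>i\<in>Basis. (w \<bullet> i) *\<^sub>R (L i - L' i))"
    using linear_on_Basis[OF linear_compose_sub[OF assms], of w] by simp
  also have "norm \<dots> \<le> (\<Sum>i\<in>Basis. norm (L i - L' i) * norm w)"
    by (rule sum_norm_le) (simp add: mult.commute[of _ "norm w"] Basis_le_norm mult_right_mono)
  finally show ?thesis
    by (simp add: sum_distrib_right)
qed

text \<open>An injective linear map is bounded below by some \<open>B\<close>, and maps near it on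
  the basis differ by at most \<open>B / 2\<close> in operator norm. This uniform lower bound stands
  in for continuity of the inverse matrix.\<close>

lemma linear_family_bounded_below:
  fixes G :: "'a::t2_space \<Rightarrow> 'b::euclidean_space \<Rightarrow> 'c::euclidean_space"
  assumes "open S" "x \<in> S" "\<And>y. y \<in> S \<Longrightarrow> linear (G y)" "inj (G x)"
    and "\<And>w. isCont (\<lambda>y. G y w) x"
  obtains m where "m > 0" "\<forall>\<^sub>F y in at x. y \<in> S \<and> (\<forall>w. m * norm w \<le> norm (G y w))"
proof -
  obtain B where B: "B > 0" "\<And>w. B * norm w \<le> norm (G x w)"
    using linear_inj_bounded_below_pos[OF assms(3)[OF assms(2)] assms(4)]
    by (metis mult.commute)
  let ?\<delta> = "\<lambda>y. \<Sum>i\<in>Basis. norm (G y i - G x i)"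
  have "(?\<delta> \<longlongrightarrow> (\<Sum>i\<in>(Basis::'b set). norm (G x i - G x i))) (at x)"
    using assms(5) by (intro tendsto_intros) (simp add: isCont_def)
  then have "(?\<delta> \<longlongrightarrow> 0) (at x)"
    by simp
  then have "\<forall>\<^sub>F y in at x. ?\<delta> y < B / 2"
    using B(1) order_tendstoD(2) half_gt_zero by blast
  moreover have "\<forall>\<^sub>F y in at x. y \<in> S"
    using assms(1,2) eventually_at_topological by blast
  ultimately have "\<forall>\<^sub>F y in at x. y \<in> S \<and> (\<forall>w. B / 2 * norm w \<le> norm (G y w))"
  proof eventually_elim
    case (elim y)
    have "B / 2 * norm w \<le> norm (G y w)" for w
    proof -
      have "norm (G y w - G x w) \<le> ?\<delta> y * norm w"
        using norm_linear_diff_le assms(2,3) elim by blast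
      also have "\<dots> \<le> B / 2 * norm w"
        using elim by (intro mult_right_mono) auto
      finally show ?thesis
        using B(2)[of w] norm_triangle_ineq2[of "G x w" "G y w"]
        by (simp add: norm_minus_commute)
    qed
    then show ?case
      using elim by blast
  qed
  then show ?thesis
    using that B(1) half_gt_zero by blast
qed

text \<open>Applying \<open>G y\<close> to \<open>X y - X x\<close> gives
  \<open>b y - G y (X x)\<close>, which tends to 0; the lower bound on \<open>G y\<close> transfers
  this to \<open>X y - X x\<close>.\<close>

lemma isCont_linear_solve:
  fixes G :: "'a::t2_space \<Rightarrow> 'b::euclidean_space \<Rightarrow> 'b"
  assumes "open S" "x \<in> S" "\<And>y. y \<in> S \<Longrightarrow> linear (G y)" "inj (G x)"
    and "\<And>y. y \<in> S \<Longrightarrow> G y (X y) = b y"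
    and "\<And>w. isCont (\<lambda>y. G y w) x" "isCont b x"
  shows "isCont X x"
proof -
  obtain m where m: "m > 0" "\<forall>\<^sub>F y in at x. y \<in> S \<and> (\<forall>w. m * norm w \<le> norm (G y w))"
    using linear_family_bounded_below[OF assms(1-4,6)] by blast
  have "((\<lambda>y. norm (b y - G y (X x)) / m) \<longlongrightarrow> norm (b x - G x (X x)) / m) (at x)"
    using assms(6,7) m(1) by (intro tendsto_intros) (auto simp: isCont_def)
  then have "((\<lambda>y. norm (b y - G y (X x)) / m) \<longlongrightarrow> 0) (at x)"
    using assms(2,5) by simp
  moreover have "\<forall>\<^sub>F y in at x. norm (X y - X x) \<le> norm (b y - G y (X x)) / m"
    using m(2)
  proof eventually_elim
    case (elim y)
    then have "b y - G y (X x) = G y (X y - X x)"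
      using assms(3,5) by (simp add: linear_diff)
    then show ?case
      using m(1) elim by (simp add: pos_le_divide_eq mult.commute)
  qed
  ultimately have "((\<lambda>y. X y - X x) \<longlongrightarrow> 0) (at x)"
    by (rule Lim_null_comparison[rotated])
  then show ?thesis
    using LIM_zero_cancel isCont_def by blast
qed

text \<open>The derivative is the one obtained by differentiating \<open>G X = b\<close> formally.
  Differentiability of \<open>X\<close> cannot be presupposed, so the remainder is estimated
  directly.\<close>

lemma has_derivative_linear_solve:
  fixes G :: "'a::euclidean_space \<Rightarrow> 'b::euclidean_space \<Rightarrow> 'b"
  assumes "open S" "x \<in> S" "\<And>y. y \<in> S \<Longrightarrow> linear (G y)" "inj (G x)"
    and "\<And>y. y \<in> S \<Longrightarrow> G y (X y) = b y"
    and "\<And>w. ((\<lambda>y. G y w) has_derivative G' w) (at x)" "(b has_derivative b') (at x)"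
  shows "(X has_derivative (\<lambda>v. inv (G x) (b' v - G' (X x) v))) (at x)"
proof -
  define u where "u y = b y - G y (X x)" for y
  define u' where "u' v = b' v - G' (X x) v" for v
  have u: "(u has_derivative u') (at x)"
    unfolding u_def u'_def by (intro derivative_intros assms(6,7))
  have u0: "u x = 0"
    using assms(2,5) by (simp add: u_def)
  have lin: "linear (G x)"
    using assms(2,3) by blast
  have GH: "G x (inv (G x) w) = w" for w
    using linear_injective_imp_surjective[OF lin assms(4)] by (simp add: surj_f_inv_f)
  have linH: "linear (inv (G x))"
    by (intro linearI inv_f_eq[OF assms(4)]) (simp_all add: linear_add[OF lin] linear_scale[OF lin] GH)
  have bl: "bounded_linear (\<lambda>v. inv (G x) (u' v))"
    using linear_compose[OF has_derivative_linear[OF u] linH]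
    by (simp add: o_def linear_linear)
  then obtain K where K: "\<And>v. norm (inv (G x) (u' v)) \<le> norm v * K"
    using bounded_linear.bounded by blast
  have cont: "isCont (\<lambda>y. G y w) x" for w
    using assms(6) has_derivative_continuous by blast
  obtain m where m: "m > 0" "\<forall>\<^sub>F y in at x. y \<in> S \<and> (\<forall>w. m * norm w \<le> norm (G y w))"
    using linear_family_bounded_below[OF assms(1-4) cont] by blast
  define \<delta> where "\<delta> y = (\<Sum>i\<in>Basis. norm (G y i - G x i))" for y
  have \<delta>0: "\<delta> y \<ge> 0" for y
    by (simp add: \<delta>_def sum_nonneg)
  have "(\<delta> \<longlongrightarrow> (\<Sum>i\<in>(Basis::'b set). norm (G x i - G x i))) (at x)"
    unfolding \<delta>_def using cont by (intro tendsto_intros) (simp add: isCont_def)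
  then have \<delta>: "(\<delta> \<longlongrightarrow> 0) (at x)"
    by simp
  define R where "R y = norm (u y - u x - u' (y - x)) / norm (y - x)" for y
  have R: "(R \<longlongrightarrow> 0) (at x)"
    using u unfolding has_derivative_iff_norm R_def by simp
  have "((\<lambda>y. (R y + \<delta> y * K) / m) \<longlongrightarrow> (0 + 0 * K) / m) (at x)"
    using R \<delta> m(1) by (intro tendsto_intros) auto
  then have lim: "((\<lambda>y. (R y + \<delta> y * K) / m) \<longlongrightarrow> 0) (at x)"
    by simp
  have "\<forall>\<^sub>F y in at x. norm (norm (X y - X x - inv (G x) (u' (y - x))) / norm (y - x))
      \<le> (R y + \<delta> y * K) / m"
    using m(2) eventually_at_ball'[OF zero_less_one]
  proof eventually_elim
    case (elim y)
    let ?w = "inv (G x) (u' (y - x))"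
    have y: "y \<in> S" "norm (y - x) > 0"
      using elim by auto
    \<comment> \<open>Since \<open>G x ?w = u' (y - x)\<close>, the error splits into the remainder
      of \<open>u\<close> and the variation of \<open>G\<close> on \<open>?w\<close>. The latter is
      at most \<open>\<delta> y\<close> times a multiple of \<open>norm (y - x)\<close>, so both are
      of smaller order than \<open>norm (y - x)\<close>.\<close>
    have "G y (X y - X x - ?w) = (u y - u x - u' (y - x)) - (G y ?w - G x ?w)"
      using assms(3,5)[OF y(1)] u0 GH by (simp add: linear_diff u_def)
    then have "norm (G y (X y - X x - ?w)) \<le> norm (u y - u x - u' (y - x)) + norm (G y ?w - G x ?w)"
      by (simp add: norm_triangle_ineq4)
    moreover have "norm (G y ?w - G x ?w) \<le> \<delta> y * norm ?w"
      unfolding \<delta>_def using norm_linear_diff_le assms(3) y(1) lin by blast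
    moreover have "\<delta> y * norm ?w \<le> \<delta> y * (norm (y - x) * K)"
      using K \<delta>0 by (intro mult_left_mono) auto
    moreover have "norm (u y - u x - u' (y - x)) = R y * norm (y - x)"
      using y by (simp add: R_def)
    moreover have "m * norm (X y - X x - ?w) \<le> norm (G y (X y - X x - ?w))"
      using elim by blast
    ultimately have "m * norm (X y - X x - ?w) \<le> (R y + \<delta> y * K) * norm (y - x)"
      by (simp add: algebra_simps)
    then show ?case
      using m(1) y(2) by (simp add: field_simps)
  qed
  then have "((\<lambda>y. norm (X y - X x - inv (G x) (u' (y - x))) / norm (y - x)) \<longlongrightarrow> 0) (at x)"
    using lim by (rule Lim_null_comparison)
  then show ?thesis
    using bl unfolding has_derivative_iff_norm u'_def by simp
qed

text \<open>Smooth dependence of the solution of a linear system on its coefficients; differentiating the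
  system \<open>G X = b\<close> gives a system with the same matrix for the derivative of \<open>X\<close>, so that no
  determinants are needed.\<close>

lemma Ck_on_linear_solve:
  fixes G :: "'a::euclidean_space \<Rightarrow> 'b::euclidean_space \<Rightarrow> 'b"
  assumes "open S" "\<And>y. y \<in> S \<Longrightarrow> linear (G y)" "\<And>y. y \<in> S \<Longrightarrow> inj (G y)"
    and "\<And>y. y \<in> S \<Longrightarrow> G y (X y) = b y"
    and "\<And>w. Ck_on k S (\<lambda>y. G y w)" "Ck_on k S b"
  shows "Ck_on k S X"
  using assms(4-6)
proof (induction k arbitrary: X b)
  case 0
  have "isCont X x" if x: "x \<in> S" for x
    using 0(2,3) x assms(1)
    by (intro isCont_linear_solve[where G = G and X = X and b = b, OF assms(1) x assms(2)
          assms(3)[OF x] 0(1)])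
      (auto simp: continuous_on_eq_continuous_at)
  then show ?case
    using assms(1) by (simp add: continuous_on_eq_continuous_at)
next
  case (Suc k)
  let ?G' = "\<lambda>x w. frechet_derivative (\<lambda>y. G y w) (at x)"
  define c where "c v x = frechet_derivative b (at x) v - ?G' x (X x) v" for v x
  have X: "Ck_on k S X"
    by (rule Suc.IH[OF Suc.prems(1)]) (use Suc.prems(2,3) Ck_on_SucD in blast)+
  have G': "((\<lambda>y. G y w) has_derivative ?G' x w) (at x)" if "x \<in> S" for x w
    using Ck_on_has_derivative[OF Suc.prems(2) that] .
  \<comment> \<open>In \<open>c\<close> the argument \<open>w\<close> is \<open>X x\<close>, which
    moves with the point. Linearity in \<open>w\<close> reduces it to fixed basis vectors, for which
    the regularity of the derivative is known.\<close>
  have G'_eq: "?G' x w v = (\<Sum>i\<in>Basis. (w \<bullet> i) *\<^sub>R ?G' x i v)" if "x \<in> S" for x w v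
  proof -
    have "((\<lambda>y. G y w) has_derivative (\<lambda>v. \<Sum>i\<in>Basis. (w \<bullet> i) *\<^sub>R ?G' x i v)) (at x)"
    proof (rule has_derivative_transform_within_open[OF _ assms(1) that])
      show "((\<lambda>y. \<Sum>i\<in>Basis. (w \<bullet> i) *\<^sub>R G y i) has_derivative
          (\<lambda>v. \<Sum>i\<in>Basis. (w \<bullet> i) *\<^sub>R ?G' x i v)) (at x)"
        by (intro has_derivative_sum has_derivative_scaleR_right G' that)
      show "(\<Sum>i\<in>Basis. (w \<bullet> i) *\<^sub>R G y i) = G y w" if "y \<in> S" for y
        using linear_on_Basis[OF assms(2)[OF that], of w] by (rule sym)
    qed
    from frechet_derivative_eqI[OF this] show ?thesis
      by (rule fun_cong)
  qed
  have c_eq: "c v x = frechet_derivative b (at x) v +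
      - (\<Sum>i\<in>Basis. (X x \<bullet> i) *\<^sub>R ?G' x i v)" if "x \<in> S" for v x
    unfolding c_def G'_eq[OF that, of "X x"] by simp
  have c: "Ck_on k S (c v)" for v
  proof -
    have "Ck_on k S (\<lambda>x. frechet_derivative b (at x) v +
        - (\<Sum>i\<in>Basis. (X x \<bullet> i) *\<^sub>R ?G' x i v))"
      using X Suc.prems(2,3)
      by (intro Ck_on_add Ck_on_bounded_linear[OF bounded_linear_minus[OF bounded_linear_ident]]
          Ck_on_sum assms(1)
          Ck_on_bounded_bilinear[OF bounded_bilinear_scaleR]
          Ck_on_bounded_linear[OF bounded_linear_inner_left]) auto
    then show ?thesis
      using Ck_on_cong[OF assms(1), of "c v", OF c_eq] by blast
  qed
  have surj: "surj (G x)" if "x \<in> S" for x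
    using linear_injective_imp_surjective assms(2,3) that by blast
  show ?case
  proof (rule Ck_on_SucI[OF assms(1)])
    show "(X has_derivative (\<lambda>v. inv (G x) (c v x))) (at x)" if x: "x \<in> S" for x
      unfolding c_def
      by (rule has_derivative_linear_solve[where G = G and X = X and b = b, OF assms(1) x assms(2) assms(3)[OF x] Suc.prems(1)
            G'[OF x] Ck_on_has_derivative[OF Suc.prems(3) x]])
    show "Ck_on k S (\<lambda>x. inv (G x) (c v x))" for v
    proof (rule Suc.IH)
      show "G y (inv (G y) (c v y)) = c v y" if "y \<in> S" for y
        using surj[OF that] by (simp add: surj_f_inv_f)
      show "Ck_on k S (\<lambda>y. G y w)" for w
        using Suc.prems(2) Ck_on_SucD by blast
      show "Ck_on k S (c v)"
        by (rule c)
    qed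
  qed
qed

lemma smooth_on_linear_solve:
  fixes G :: "'a::euclidean_space \<Rightarrow> 'b::euclidean_space \<Rightarrow> 'b"
  assumes "open S" "\<And>y. y \<in> S \<Longrightarrow> linear (G y)" "\<And>y. y \<in> S \<Longrightarrow> inj (G y)"
    and "\<And>y. y \<in> S \<Longrightarrow> G y (X y) = b y"
    and "\<And>w. smooth_on S (\<lambda>y. G y w)" "smooth_on S b"
  shows "smooth_on S X"
  unfolding smooth_on_def
proof
  show "Ck_on k S X" for k
    by (rule Ck_on_linear_solve[OF assms(1-4)]) (use assms(5,6) in \<open>auto simp: smooth_on_def\<close>)
qed

text \<open>Division by a nonvanishing smooth function is the one-dimensional case of solving a
  linear system.\<close>

lemma smooth_on_cancel_mult:
  fixes f h :: "'a::euclidean_space \<Rightarrow> real"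
  assumes "open S" "\<And>x. x \<in> S \<Longrightarrow> h x \<noteq> 0" "smooth_on S h" "smooth_on S (\<lambda>x. h x * f x)"
  shows "smooth_on S f"
proof (rule smooth_on_linear_solve[where G = "\<lambda>x w. h x * w" and b = "\<lambda>x. h x * f x"])
  show "linear ((*) (h x))" for x
    by (simp add: linear_times)
  show "inj ((*) (h x))" if "x \<in> S" for x
    using assms(2)[OF that] by (auto intro: injI)
  show "smooth_on S (\<lambda>x. h x * w)" for w
    by (intro smooth_on_mult smooth_on_const assms)
qed (use assms in auto)


section \<open>Bump functions\<close>

text \<open>The index \<open>n\<close> is there because differentiating the flat function exp(-1/t)
  produces powers of 1/t; linear combinations of the whole family are closed under
  differentiation.\<close>

definition exp_decay :: "nat \<Rightarrow> real \<Rightarrow> real" where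
  "exp_decay n t = (if t > 0 then (1 / t) ^ n * exp (- (1 / t)) else 0)"

text \<open>With s = 1/t, the single term of degree n + 2 in the series bounds exp s from below. The
  two powers beyond n become the square of t, which is what forces derivative 0 at the
  origin.\<close>

lemma exp_decay_le: "\<bar>exp_decay n t\<bar> \<le> fact (n + 2) * t\<^sup>2"
proof (cases "t > 0")
  case True
  define s where "s = 1 / t"
  have s: "s > 0" "s * t = 1"
    using True by (auto simp: s_def)
  have "s ^ (n + 2) / fact (n + 2) \<le> exp s"
  proof -
    have "summable (\<lambda>i. inverse (fact i) * s ^ i)"
      using summable_exp[of s] by simp
    then have "(\<Sum>i\<in>{n+2}. inverse (fact i) * s ^ i) \<le> (\<Sum>i. inverse (fact i) * s ^ i)"
      using s(1) by (intro sum_le_suminf) auto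
    then show ?thesis
      by (simp add: exp_def field_simps)
  qed
  then have "s ^ (n + 2) * exp (- s) \<le> fact (n + 2)"
    unfolding exp_minus divide_inverse[symmetric]
    by (simp add: pos_divide_le_eq mult.commute del: fact_Suc power_Suc add_2_eq_Suc')
  then have "s ^ (n + 2) * exp (- s) * t\<^sup>2 \<le> fact (n + 2) * t\<^sup>2"
    by (rule mult_right_mono) simp
  moreover have "s ^ (n + 2) * exp (- s) * t\<^sup>2 = s ^ n * exp (- s) * (s * t)\<^sup>2"
    by (simp add: power_add power_mult_distrib power2_eq_square mult_ac)
  ultimately have "s ^ n * exp (- s) \<le> fact (n + 2) * t\<^sup>2"
    unfolding s(2) by (simp del: power_Suc fact_Suc add_2_eq_Suc')
  then show ?thesis
    using True s(1) by (simp add: exp_decay_def s_def[symmetric] del: fact_Suc)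
qed (simp add: exp_decay_def)

lemma has_derivative_exp_decay:
  "(exp_decay n has_derivative (\<lambda>v. (exp_decay (n + 2) t - n * exp_decay (n + 1) t) * v)) (at t)"
proof -
  consider "t > 0" | "t < 0" | "t = 0"
    by linarith
  then show ?thesis
  proof cases
    case 1
    \<comment> \<open>The right-hand side is the shape delivered by the product rule. The exponent
      \<open>n - 1\<close> is truncated at \<open>n = 0\<close>, where the factor \<open>n\<close>
      removes the term, hence the case split.\<close>
    have eq: "exp_decay (n + 2) t - n * exp_decay (n + 1) t =
        (n * (1 / t) ^ (n - 1) * (- (1 / t\<^sup>2))) * exp (- (1 / t)) +
        (1 / t) ^ n * (exp (- (1 / t)) * (1 / t\<^sup>2))"
      using 1 by (cases n) (auto simp: exp_decay_def field_simps power2_eq_square)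
    have "((\<lambda>t. (1 / t) ^ n * exp (- (1 / t))) has_real_derivative
        exp_decay (n + 2) t - n * exp_decay (n + 1) t) (at t)"
      unfolding eq using 1
      by (auto intro!: derivative_eq_intros simp: power2_eq_square algebra_simps)
    then have "((\<lambda>t. (1 / t) ^ n * exp (- (1 / t))) has_derivative
        (\<lambda>v. (exp_decay (n + 2) t - n * exp_decay (n + 1) t) * v)) (at t)"
      by (simp add: has_field_derivative_def)
    then show ?thesis
      by (rule has_derivative_transform_within_open[where s = "{0<..}"])
        (use 1 in \<open>auto simp: exp_decay_def\<close>)
  next
    case 2
    have "((\<lambda>t. 0) has_derivative (\<lambda>v. 0::real)) (at t)"
      by simp
    then have "(exp_decay n has_derivative (\<lambda>v. 0)) (at t)"
      by (rule has_derivative_transform_within_open[where s = "{..<0}"])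
        (use 2 in \<open>auto simp: exp_decay_def\<close>)
    then show ?thesis
      using 2 by (simp add: exp_decay_def)
  next
    case 3
    have "((\<lambda>y. norm (exp_decay n y) / norm y) \<longlongrightarrow> 0) (at 0)"
    proof (rule Lim_null_comparison)
      show "\<forall>\<^sub>F y in at 0. norm (norm (exp_decay n y) / norm y) \<le> fact (n + 2) * \<bar>y\<bar>"
        using exp_decay_le[of n]
        by (auto simp: eventually_at_filter divide_le_eq power2_eq_square abs_mult_self_eq mult.assoc)
      show "((\<lambda>y::real. fact (n + 2) * \<bar>y\<bar>) \<longlongrightarrow> 0) (at 0)"
        by (rule tendsto_eq_intros | simp)+
    qed
    then show ?thesis
      using 3 by (simp add: has_derivative_iff_norm exp_decay_def)
  qed
qed

lemma smooth_on_exp_decay: "smooth_on UNIV (exp_decay n)"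
  unfolding smooth_on_def
proof
  show "Ck_on k UNIV (exp_decay n)" for k
  proof (induction k arbitrary: n)
    case 0
    then show ?case
      using has_derivative_exp_decay
      by (auto intro!: continuous_at_imp_continuous_on has_derivative_continuous)
  next
    case (Suc k)
    show ?case
    proof (rule Ck_on_SucI[OF open_UNIV has_derivative_exp_decay])
      fix v :: real
      have "Ck_on k UNIV (\<lambda>t. v * exp_decay (n + 2) t + (- (n * v)) * exp_decay (n + 1) t)"
        by (intro Ck_on_add Ck_on_bounded_linear[OF bounded_linear_mult_right] Suc.IH open_UNIV)
      then show "Ck_on k UNIV (\<lambda>t. (exp_decay (n + 2) t - n * exp_decay (n + 1) t) * v)"
        by (simp add: algebra_simps)
    qed
  qed
qed

text \<open>The squared distance is used because it is smooth at the centre too. The value at the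
  centre is not normalized to 1.\<close>

definition bump :: "'a::euclidean_space \<Rightarrow> real \<Rightarrow> 'a \<Rightarrow> real" where
  "bump a r x = exp_decay 0 (r\<^sup>2 - (x - a) \<bullet> (x - a))"

lemma smooth_on_bump: "smooth_on UNIV (bump a r)"
proof -
  have d: "smooth_on UNIV (\<lambda>x. x + (- a))"
    by (intro smooth_on_add smooth_on_id smooth_on_const open_UNIV)
  have "smooth_on UNIV (\<lambda>x. r\<^sup>2 + (- 1) * ((x + (- a)) \<bullet> (x + (- a))))"
    by (intro smooth_on_add smooth_on_mult smooth_on_inner smooth_on_const d open_UNIV)
  from smooth_on_compose[OF open_UNIV open_UNIV _ this smooth_on_exp_decay]
  have "smooth_on UNIV (\<lambda>x. exp_decay 0 (r\<^sup>2 + (- 1) * ((x + (- a)) \<bullet> (x + (- a)))))"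
    by blast
  then show ?thesis
    by (simp add: bump_def[abs_def])
qed

lemma bump_eq_0_iff: "r > 0 \<Longrightarrow> bump a r x = 0 \<longleftrightarrow> x \<notin> ball a r"
proof -
  assume "r > 0"
  then have "r\<^sup>2 - (x - a) \<bullet> (x - a) > 0 \<longleftrightarrow> norm (x - a) < r"
    unfolding power2_norm_eq_inner[symmetric]
    by (simp add: power_mono_iff power2_less_imp_less power_strict_mono flip: not_le)
  then show ?thesis
    by (simp add: bump_def exp_decay_def dist_norm norm_minus_commute)
qed

section \<open>Charts and coordinate vectors\<close>

definition overlap :: "('m, 'e) chart \<Rightarrow> ('m, 'e) chart \<Rightarrow> 'e set" where
  "overlap c d = snd c ` (fst c \<inter> fst d)"

locale smooth_mfd =
  fixes M :: "('m, 'e::euclidean_space) mfd"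
  assumes smooth_manifold: "smooth_manifold M"
begin

lemma is_chart: "c \<in> atlas M \<Longrightarrow> is_chart (mtop M) c"
  using smooth_manifold by (simp add: smooth_manifold_def)

lemma chart_subset_points: "c \<in> atlas M \<Longrightarrow> fst c \<subseteq> points M"
  using is_chart by (simp add: is_chart_def openin_subset)

lemma homeomorphic_chart:
  "c \<in> atlas M \<Longrightarrow> homeomorphic_map (subtopology (mtop M) (fst c)) (top_of_set (cimage c)) (snd c)"
  using is_chart by (simp add: is_chart_def)

lemma inj_on_chart: "c \<in> atlas M \<Longrightarrow> inj_on (snd c) (fst c)"
  using homeomorphic_imp_injective_map[OF homeomorphic_chart] chart_subset_points
  by (simp add: inf.absorb2)

lemma cinv_chart [simp]: "c \<in> atlas M \<Longrightarrow> q \<in> fst c \<Longrightarrow> cinv c (snd c q) = q"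
  by (simp add: cinv_def inj_on_chart)

lemma cinv_in [simp]: "x \<in> cimage c \<Longrightarrow> cinv c x \<in> fst c"
  by (simp add: cinv_def cimage_def inv_into_into)

lemma chart_cinv [simp]: "x \<in> cimage c \<Longrightarrow> snd c (cinv c x) = x"
  by (simp add: cinv_def cimage_def f_inv_into_f)

lemma chart_in_cimage [simp]: "q \<in> fst c \<Longrightarrow> snd c q \<in> cimage c"
  by (simp add: cimage_def)

lemma open_cimage: "c \<in> atlas M \<Longrightarrow> open (cimage c)"
  using is_chart by (simp add: is_chart_def)

lemma open_chart_image:
  assumes "c \<in> atlas M" "openin (mtop M) U"
  shows "open (snd c ` (fst c \<inter> U))"
proof -
  have "openin (subtopology (mtop M) (fst c)) (fst c \<inter> U)"
    using assms(2) by (metis openin_subtopology_Int2)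
  then have "openin (top_of_set (cimage c)) (snd c ` (fst c \<inter> U))"
    using homeomorphic_imp_open_map[OF homeomorphic_chart[OF assms(1)]]
    by (simp add: open_map_def)
  then show ?thesis
    using open_cimage[OF assms(1)] openin_open_eq by blast
qed

lemma openin_chart: "c \<in> atlas M \<Longrightarrow> openin (mtop M) (fst c)"
  using is_chart by (simp add: is_chart_def)

lemma open_overlap: "c \<in> atlas M \<Longrightarrow> d \<in> atlas M \<Longrightarrow> open (overlap c d)"
  unfolding overlap_def by (intro open_chart_image openin_chart)

lemma overlap_subset: "overlap c d \<subseteq> cimage c"
  by (auto simp: overlap_def cimage_def)

lemma transition_chart [simp]:
  "c \<in> atlas M \<Longrightarrow> q \<in> fst c \<Longrightarrow> transition c d (snd c q) = snd d q"
  by (simp add: transition_def)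

lemma smooth_transition:
  "c \<in> atlas M \<Longrightarrow> d \<in> atlas M \<Longrightarrow> smooth_on (overlap c d) (transition c d)"
  using smooth_manifold by (simp add: smooth_manifold_def overlap_def)

lemma charts_at_cover: "p \<in> points M \<Longrightarrow> \<exists>c. c \<in> charts_at M p"
  using smooth_manifold unfolding smooth_manifold_def charts_at_def by blast

lemma charts_atD: "c \<in> charts_at M p \<Longrightarrow> c \<in> atlas M \<and> p \<in> fst c"
  by (simp add: charts_at_def)

lemma charts_at_cinv: "c \<in> atlas M \<Longrightarrow> x \<in> cimage c \<Longrightarrow> c \<in> charts_at M (cinv c x)"
  by (simp add: charts_at_def)

lemma charts_at_points: "c \<in> charts_at M p \<Longrightarrow> p \<in> points M"
  using chart_subset_points unfolding charts_at_def by blast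

lemma transition_has_derivative:
  assumes "c \<in> charts_at M p" "d \<in> charts_at M p"
  shows "(transition c d has_derivative frechet_derivative (transition c d) (at (snd c p)))
    (at (snd c p))"
  using assms by (intro smooth_on_has_derivative[OF smooth_transition])
    (auto simp: charts_at_def overlap_def)

lemma transition_derivative_refl:
  assumes "c \<in> charts_at M p"
  shows "frechet_derivative (transition c c) (at (snd c p)) = (\<lambda>w. w)"
proof -
  have "c \<in> atlas M" "p \<in> fst c"
    using assms by (auto simp: charts_at_def)
  then have "(transition c c has_derivative (\<lambda>w. w)) (at (snd c p))"
    by (intro has_derivative_transform_within_open[OF has_derivative_ident open_cimage[of c]])
      (auto simp: transition_def)
  then show ?thesis
    by (rule frechet_derivative_eqI)
qed

text \<open>The chain rule on the triple overlap. It is what makes the family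
  \<open>coord_vec\<close> consistent across charts, hence a tangent vector.\<close>

lemma transition_derivative_cocycle:
  assumes c: "c \<in> charts_at M p" and d: "d \<in> charts_at M p" and e: "e \<in> charts_at M p"
  shows "frechet_derivative (transition d e) (at (snd d p))
      (frechet_derivative (transition c d) (at (snd c p)) w) =
    frechet_derivative (transition c e) (at (snd c p)) w"
proof -
  let ?cd = "frechet_derivative (transition c d) (at (snd c p))"
    and ?de = "frechet_derivative (transition d e) (at (snd d p))"
  note [simp] = charts_atD[OF c] charts_atD[OF d] charts_atD[OF e]
  have "(transition d e has_derivative ?de) (at (transition c d (snd c p)))"
    using transition_has_derivative[OF d e] by simp
  then have "(transition d e \<circ> transition c d has_derivative ?de \<circ> ?cd) (at (snd c p))"
    by (rule diff_chain_at[OF transition_has_derivative[OF c d]])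
  moreover have "open (snd c ` (fst c \<inter> (fst d \<inter> fst e)))"
    by (intro open_chart_image openin_Int openin_chart) simp_all
  ultimately have "(transition c e has_derivative ?de \<circ> ?cd) (at (snd c p))"
    by (rule has_derivative_transform_within_open) auto
  from frechet_derivative_eqI[OF this] show ?thesis
    by simp
qed

lemma tangentI:
  assumes "\<And>c. c \<notin> charts_at M p \<Longrightarrow> v c = 0"
    and "\<And>c d. c \<in> charts_at M p \<Longrightarrow> d \<in> charts_at M p \<Longrightarrow>
      v d = frechet_derivative (transition c d) (at (snd c p)) (v c)"
  shows "v \<in> tangent_space M p"
  using assms unfolding tangent_space_def by blast

lemma tangentD:
  assumes "v \<in> tangent_space M p"
  shows "c \<notin> charts_at M p \<Longrightarrow> v c = 0"
    and "c \<in> charts_at M p \<Longrightarrow> d \<in> charts_at M p \<Longrightarrow>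
      frechet_derivative (transition c d) (at (snd c p)) (v c) = v d"
  proof -
  show "v c = 0" if "c \<notin> charts_at M p"
    using assms that unfolding tangent_space_def by blast
  show "frechet_derivative (transition c d) (at (snd c p)) (v c) = v d"
    if "c \<in> charts_at M p" "d \<in> charts_at M p"
  proof -
    have "\<forall>c\<in>charts_at M p. \<forall>d\<in>charts_at M p.
        v d = frechet_derivative (transition c d) (at (snd c p)) (v c)"
      using assms unfolding tangent_space_def mem_Collect_eq by (rule conjunct2)
    from bspec[OF bspec[OF this that(1)] that(2)] show ?thesis
      by (rule sym)
  qed
qed

lemma coord_vec_self: "c \<in> charts_at M p \<Longrightarrow> coord_vec M c e p c = e"
  by (simp add: coord_vec_def transition_derivative_refl)

lemma coord_vec_tangent: "c \<in> charts_at M p \<Longrightarrow> coord_vec M c e p \<in> tangent_space M p"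
  by (rule tangentI) (simp_all add: coord_vec_def transition_derivative_cocycle)

lemma coord_vec_eq: "c \<in> charts_at M p \<Longrightarrow> v \<in> tangent_space M p \<Longrightarrow> coord_vec M c (v c) p = v"
  by (simp add: coord_vec_def tangentD fun_eq_iff)

lemma transition_derivative_linear:
  "c \<in> charts_at M p \<Longrightarrow> d \<in> charts_at M p \<Longrightarrow>
    linear (frechet_derivative (transition c d) (at (snd c p)))"
  using transition_has_derivative has_derivative_linear by blast

lemma coord_vec_add:
  "c \<in> charts_at M p \<Longrightarrow>
    coord_vec M c (a + b) p = (\<lambda>k. coord_vec M c a p k + coord_vec M c b p k)"
  by (auto simp: coord_vec_def fun_eq_iff linear_add[OF transition_derivative_linear])

lemma coord_vec_scale:
  "c \<in> charts_at M p \<Longrightarrow> coord_vec M c (r *\<^sub>R a) p = (\<lambda>k. r *\<^sub>R coord_vec M c a p k)"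
  by (auto simp: coord_vec_def fun_eq_iff linear_scale[OF transition_derivative_linear])

lemma tangent_add:
  "v \<in> tangent_space M p \<Longrightarrow> w \<in> tangent_space M p \<Longrightarrow> (\<lambda>k. v k + w k) \<in> tangent_space M p"
  by (rule tangentI) (simp_all add: linear_add[OF transition_derivative_linear] tangentD)

lemma tangent_scale: "v \<in> tangent_space M p \<Longrightarrow> (\<lambda>k. r *\<^sub>R v k) \<in> tangent_space M p"
  by (rule tangentI) (simp_all add: linear_scale[OF transition_derivative_linear] tangentD)

lemma tangent_0: "(\<lambda>_. 0) \<in> tangent_space M p"
  by (rule tangentI) (simp_all add: linear_0[OF transition_derivative_linear])

lemma linear_functional_coord:
  assumes "c \<in> charts_at M p" "linear_functional_on (tangent_space M p) l"
  shows "linear (\<lambda>e. l (coord_vec M c e p))"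
  using assms coord_vec_tangent[OF assms(1)]
  by (intro linearI) (auto simp: coord_vec_add coord_vec_scale linear_functional_on_def)

lemma linear_functional_expand:
  assumes "c \<in> charts_at M p" "linear_functional_on (tangent_space M p) l" "v \<in> tangent_space M p"
  shows "l v = (\<Sum>i\<in>Basis. (v c \<bullet> i) * l (coord_vec M c i p))"
  using linear_on_Basis[OF linear_functional_coord[OF assms(1,2)], of "v c"]
  by (simp add: coord_vec_eq assms)


section \<open>Extending local data by bump functions\<close>

lemma smooth_on_change_chart:
  assumes "c \<in> atlas M" "d \<in> atlas M" "smooth_on (overlap c d) (\<lambda>y. f (cinv c y))"
  shows "smooth_on (overlap d c) (\<lambda>x. f (cinv d x))"
proof -
  have "smooth_on (overlap d c) (\<lambda>x. f (cinv c (transition d c x)))"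
    using assms
    by (intro smooth_on_compose[OF _ _ _ smooth_transition assms(3)] open_overlap)
      (auto simp: overlap_def)
  then show ?thesis
    using assms
    by (elim smooth_on_transform) (auto simp: overlap_def open_overlap[unfolded overlap_def])
qed

text \<open>Compactness is transported through the chart, and the Hausdorff property turns compact
  into closed in all of \<open>M\<close>, not merely in the chart domain.\<close>

lemma closedin_chart_preimage_compact:
  assumes "c \<in> atlas M" "compact K" "K \<subseteq> cimage c"
  shows "closedin (mtop M) {q \<in> fst c. snd c q \<in> K}"
proof -
  let ?A = "{q \<in> fst c. snd c q \<in> K}"
  have "snd c ` ?A = K"
    using assms(3) by (auto simp: cimage_def)
  then have "compactin (top_of_set (cimage c)) (snd c ` ?A)"
    using assms(2,3) by (simp add: compactin_subtopology)
  then have "compactin (subtopology (mtop M) (fst c)) ?A"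
    using homeomorphic_map_compactness[OF homeomorphic_chart[OF assms(1)], of ?A]
      chart_subset_points[OF assms(1)] by auto
  then show ?thesis
    using smooth_manifold compactin_imp_closedin
    by (auto simp: compactin_subtopology smooth_manifold_def)
qed

text \<open>The image of \<open>d\<close> is the union of two open sets: the overlap with
  \<open>c\<close>, where smoothness is assumed in the coordinates of \<open>c\<close>, and the part
  away from the compact support, where \<open>f\<close> vanishes.\<close>

lemma smooth_on_extend_by_zero:
  fixes f :: "'m \<Rightarrow> 'b::real_normed_vector"
  assumes "c \<in> atlas M" "d \<in> atlas M" "compact K" "K \<subseteq> cimage c"
    and "smooth_on (overlap c d) (\<lambda>y. f (cinv c y))"
    and "\<And>q. q \<in> fst d \<Longrightarrow> \<not> (q \<in> fst c \<and> snd c q \<in> K) \<Longrightarrow> f q = 0"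
  shows "smooth_on (cimage d) (\<lambda>x. f (cinv d x))"
proof -
  let ?U = "snd d ` (fst d \<inter> (points M - {q \<in> fst c. snd c q \<in> K}))"
  have U: "open ?U"
    using closedin_chart_preimage_compact[OF assms(1,3,4)] assms(2)
    by (intro open_chart_image) (auto intro: openin_diff)
  have "smooth_on ?U (\<lambda>x. f (cinv d x))"
  proof (rule smooth_on_transform[OF smooth_on_const U])
    show "0 = f (cinv d x)" if "x \<in> ?U" for x
    proof -
      from that obtain q where "q \<in> fst d" "x = snd d q" "\<not> (q \<in> fst c \<and> snd c q \<in> K)"
        by blast
      then show ?thesis
        using assms(2,6) by simp
    qed
  qed
  then have "smooth_on (overlap d c \<union> ?U) (\<lambda>x. f (cinv d x))"
    using U smooth_on_change_chart[OF assms(1,2,5)] open_overlap[OF assms(2,1)]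
    by (intro smooth_on_open_Un) auto
  moreover have "cimage d = overlap d c \<union> ?U"
    using chart_subset_points[OF assms(2)] by (auto simp: overlap_def cimage_def)
  ultimately show ?thesis
    by simp
qed

definition chart_fun :: "('m, 'e) chart \<Rightarrow> ('e \<Rightarrow> real) \<Rightarrow> 'm \<Rightarrow> real" where
  "chart_fun c \<phi> q = (if q \<in> fst c then \<phi> (snd c q) else 0)"

text \<open>The constant coordinate field in direction \<open>e\<close>, cut off by
  \<open>\<phi>\<close> so that it can live on the whole manifold.\<close>

definition chart_field :: "('m, 'e) chart \<Rightarrow> ('e \<Rightarrow> real) \<Rightarrow> 'e \<Rightarrow> ('m, 'e) vfield" where
  "chart_field c \<phi> e q = (\<lambda>k. chart_fun c \<phi> q *\<^sub>R coord_vec M c e q k)"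

lemma chart_fun_smooth:
  assumes "c \<in> atlas M" "compact K" "K \<subseteq> cimage c" "smooth_on (cimage c) \<phi>"
    and "\<And>x. x \<notin> K \<Longrightarrow> \<phi> x = 0"
  shows "chart_fun c \<phi> \<in> smooth_functions M"
proof -
  have "smooth_on (cimage d) (\<lambda>x. chart_fun c \<phi> (cinv d x))" if d: "d \<in> atlas M" for d
  proof (rule smooth_on_extend_by_zero[OF assms(1) d assms(2,3)])
    have "smooth_on (overlap c d) \<phi>"
      by (rule smooth_on_subset[OF assms(4) overlap_subset])
    then show "smooth_on (overlap c d) (\<lambda>y. chart_fun c \<phi> (cinv c y))"
      using overlap_subset[of c d] open_overlap[OF assms(1) d]
      by (elim smooth_on_transform) (auto simp: chart_fun_def dest: subsetD)
  qed (use assms(5) in \<open>auto simp: chart_fun_def\<close>)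
  then show ?thesis
    using chart_subset_points[OF assms(1)]
    by (auto simp: smooth_functions_def chart_fun_def o_def)
qed

lemma chart_field_vector_field:
  assumes "c \<in> atlas M" "compact K" "K \<subseteq> cimage c" "smooth_on (cimage c) \<phi>"
    and "\<And>x. x \<notin> K \<Longrightarrow> \<phi> x = 0"
  shows "chart_field c \<phi> e \<in> vector_fields M"
proof -
  have "smooth_on (cimage d) (\<lambda>x. chart_field c \<phi> e (cinv d x) d)" if d: "d \<in> atlas M" for d
  proof (rule smooth_on_extend_by_zero[OF assms(1) d assms(2,3)])
    have "smooth_on (overlap c d) \<phi>"
      by (rule smooth_on_subset[OF assms(4) overlap_subset])
    \<comment> \<open>Seen in the chart \<open>d\<close>, the coordinate field of \<open>c\<close>
      in direction \<open>e\<close> is the directional derivative of the transition map.\<close>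
    then have "smooth_on (overlap c d)
        (\<lambda>y. \<phi> y *\<^sub>R frechet_derivative (transition c d) (at y) e)"
      by (intro smooth_on_scaleR smooth_on_frechet_derivative smooth_transition open_overlap
          assms(1) d)
    then show "smooth_on (overlap c d) (\<lambda>y. chart_field c \<phi> e (cinv c y) d)"
      using assms(1) d open_overlap[OF assms(1) d]
      by (elim smooth_on_transform)
        (auto simp: overlap_def chart_field_def chart_fun_def coord_vec_def charts_at_def)
  qed (use assms(5) in \<open>auto simp: chart_field_def chart_fun_def\<close>)
  moreover have "chart_field c \<phi> e q \<in> tangent_space M q" for q
    using assms(1) coord_vec_tangent[of c q] tangent_scale[of _ q] tangent_0
    by (cases "q \<in> fst c") (auto simp: chart_field_def chart_fun_def charts_at_def)
  ultimately show ?thesis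
    using chart_subset_points[OF assms(1)]
    by (auto simp: vector_fields_def chart_field_def chart_fun_def)
qed

text \<open>Openness of the nonvanishing set is recorded because local statements are later obtained
  there by dividing by \<open>\<phi>\<close>.\<close>

lemma chart_bump:
  assumes "c \<in> charts_at M p"
  obtains \<phi> :: "'e \<Rightarrow> real" and K where "compact K" "K \<subseteq> cimage c" "smooth_on UNIV \<phi>" "\<And>x. x \<notin> K \<Longrightarrow> \<phi> x = 0"
    "\<phi> (snd c p) \<noteq> 0" "open {x. \<phi> x \<noteq> 0}"
proof -
  have "open (cimage c)" "snd c p \<in> cimage c"
    using assms open_cimage by (auto simp: charts_at_def)
  then obtain r where r: "r > 0" "cball (snd c p) r \<subseteq> cimage c"
    using open_contains_cball by blast
  show ?thesis
  proof (rule that[OF compact_cball r(2) smooth_on_bump[of "snd c p" r]])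
    have "{x. bump (snd c p) r x \<noteq> 0} = ball (snd c p) r"
      using r(1) by (auto simp: bump_eq_0_iff)
    then show "open {x. bump (snd c p) r x \<noteq> 0}"
      by simp
  qed (use r(1) in \<open>auto simp: bump_eq_0_iff\<close>)
qed

lemma vector_field_tangent: "X \<in> vector_fields M \<Longrightarrow> X p \<in> tangent_space M p"
  using tangent_0 by (cases "p \<in> points M") (auto simp: vector_fields_def)

text \<open>The bridge between hypotheses on global sections and conclusions at a point: global
  fields attain every tangent vector.\<close>

lemma vector_field_extending:
  assumes "p \<in> points M" "v \<in> tangent_space M p"
  obtains X where "X \<in> vector_fields M" "X p = v"
proof -
  obtain c where c: "c \<in> charts_at M p"
    using charts_at_cover assms(1) by blast
  obtain \<phi> :: "'e \<Rightarrow> real" and K where \<phi>: "compact K" "K \<subseteq> cimage c" "smooth_on UNIV \<phi>" "\<And>x. x \<notin> K \<Longrightarrow> \<phi> x = 0"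
    "\<phi> (snd c p) \<noteq> 0"
    using chart_bump[OF c] by metis
  \<comment> \<open>The factor compensates for the value of the bump function at \<open>p\<close>,
    which is nonzero but not 1.\<close>
  let ?X = "chart_field c \<phi> ((1 / \<phi> (snd c p)) *\<^sub>R v c)"
  have "?X \<in> vector_fields M"
    using c \<phi> smooth_on_subset[OF \<phi>(3)]
    by (intro chart_field_vector_field[of c K]) (auto simp: charts_at_def)
  moreover have "?X p = v"
    using c \<phi>(5) coord_vec_eq[OF c assms(2)] charts_atD[OF c]
    by (simp add: chart_field_def chart_fun_def coord_vec_scale)
  ultimately show ?thesis
    by (rule that)
qed


section \<open>Sections and tensoriality\<close>

lemma vector_field_off: "X \<in> vector_fields M \<Longrightarrow> p \<notin> points M \<Longrightarrow> X p = (\<lambda>_. 0)"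
  by (simp add: vector_fields_def)

lemma vector_field_smooth:
  "X \<in> vector_fields M \<Longrightarrow> c \<in> atlas M \<Longrightarrow> smooth_on (cimage c) (\<lambda>x. X (cinv c x) c)"
  by (simp add: vector_fields_def)

lemma one_form_off: "\<xi> \<in> one_forms M \<Longrightarrow> p \<notin> points M \<Longrightarrow> \<xi> p = (\<lambda>_. 0)"
  by (simp add: one_forms_def)

lemma one_form_off_tangent: "\<xi> \<in> one_forms M \<Longrightarrow> v \<notin> tangent_space M p \<Longrightarrow> \<xi> p v = 0"
proof (cases "p \<in> points M")
  case True
  assume "\<xi> \<in> one_forms M" "v \<notin> tangent_space M p"
  then show ?thesis
    using True unfolding one_forms_def cotangent_space_def by blast
qed (simp add: one_form_off)

lemma one_form_linear: "\<xi> \<in> one_forms M \<Longrightarrow> linear_functional_on (tangent_space M p) (\<xi> p)"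
proof (cases "p \<in> points M")
  case True
  assume "\<xi> \<in> one_forms M"
  then show ?thesis
    using True unfolding one_forms_def cotangent_space_def by blast
qed (simp add: one_form_off linear_functional_on_def)

lemma one_form_add:
  "\<xi> \<in> one_forms M \<Longrightarrow> v \<in> tangent_space M p \<Longrightarrow> w \<in> tangent_space M p \<Longrightarrow>
    \<xi> p (\<lambda>k. v k + w k) = \<xi> p v + \<xi> p w"
  using one_form_linear unfolding linear_functional_on_def by blast

lemma one_form_scale:
  "\<xi> \<in> one_forms M \<Longrightarrow> v \<in> tangent_space M p \<Longrightarrow> \<xi> p (\<lambda>k. r *\<^sub>R v k) = r * \<xi> p v"
  using one_form_linear unfolding linear_functional_on_def by blast

lemma one_form_smooth:
  "\<xi> \<in> one_forms M \<Longrightarrow> c \<in> atlas M \<Longrightarrow>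
    smooth_on (cimage c) (\<lambda>x. \<xi> (cinv c x) (coord_vec M c e (cinv c x)))"
  by (simp add: one_forms_def)

lemma one_formI:
  assumes "\<And>p. p \<in> points M \<Longrightarrow> linear_functional_on (tangent_space M p) (\<xi> p)"
    and "\<And>p v. v \<notin> tangent_space M p \<Longrightarrow> \<xi> p v = 0"
    and "\<And>p v. p \<notin> points M \<Longrightarrow> \<xi> p v = 0"
    and "\<And>c e. c \<in> atlas M \<Longrightarrow>
      smooth_on (cimage c) (\<lambda>x. \<xi> (cinv c x) (coord_vec M c e (cinv c x)))"
  shows "\<xi> \<in> one_forms M"
proof -
  have "\<xi> p = (\<lambda>_. 0)" if "p \<notin> points M" for p
    using assms(3)[OF that] by (rule ext)
  then show ?thesis
    unfolding one_forms_def cotangent_space_def using assms(1,2,4) by blast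
qed

text \<open>Constants are not members of \<^const>\<open>smooth_functions\<close>, which vanish off the manifold;
  the following predicate covers both.\<close>

definition smooth_scalar :: "('m \<Rightarrow> real) \<Rightarrow> bool" where
  "smooth_scalar f \<longleftrightarrow> (\<forall>c\<in>atlas M. smooth_on (cimage c) (\<lambda>x. f (cinv c x)))"

lemma smooth_scalar_const: "smooth_scalar (\<lambda>_. r)"
  by (simp add: smooth_scalar_def smooth_on_const)

lemma smooth_scalar_smooth_function: "f \<in> smooth_functions M \<Longrightarrow> smooth_scalar f"
  by (simp add: smooth_scalar_def smooth_functions_def o_def)

lemma smooth_scalar_restrict:
  assumes "smooth_scalar f"
  shows "(\<lambda>p. if p \<in> points M then f p else 0) \<in> smooth_functions M"
proof -
  have "smooth_on (cimage c) (\<lambda>x. if cinv c x \<in> points M then f (cinv c x) else 0)"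
    if c: "c \<in> atlas M" for c
  proof (rule smooth_on_transform[OF _ open_cimage[OF c]])
    show "smooth_on (cimage c) (\<lambda>x. f (cinv c x))"
      using assms c by (simp add: smooth_scalar_def)
    show "f (cinv c x) = (if cinv c x \<in> points M then f (cinv c x) else 0)"
      if "x \<in> cimage c" for x
      using subsetD[OF chart_subset_points[OF c] cinv_in[OF that]] by simp
  qed
  then show ?thesis
    by (simp add: smooth_functions_def o_def)
qed

lemma sec_scale_restrict:
  assumes "\<And>p. p \<notin> points M \<Longrightarrow> X p = (\<lambda>_. 0)"
  shows "sec_scale (\<lambda>p. if p \<in> points M then f p else 0) X = sec_scale f X"
  using assms by (auto simp: sec_scale_def fun_eq_iff)

lemma vector_fieldI:
  assumes "\<And>p. p \<in> points M \<Longrightarrow> X p \<in> tangent_space M p"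
    and "\<And>p. p \<notin> points M \<Longrightarrow> X p = (\<lambda>_. 0)"
    and "\<And>c. c \<in> atlas M \<Longrightarrow> smooth_on (cimage c) (\<lambda>x. X (cinv c x) c)"
  shows "X \<in> vector_fields M"
  unfolding vector_fields_def using assms by blast

lemma sec_add_vector_field:
  assumes "X \<in> vector_fields M" "Y \<in> vector_fields M"
  shows "sec_add X Y \<in> vector_fields M"
  unfolding sec_add_def
proof (rule vector_fieldI)
  show "(\<lambda>k. X p k + Y p k) \<in> tangent_space M p" for p
    by (rule tangent_add[OF vector_field_tangent[OF assms(1)] vector_field_tangent[OF assms(2)]])
  show "smooth_on (cimage c) (\<lambda>x. X (cinv c x) c + Y (cinv c x) c)" if "c \<in> atlas M" for c
    by (rule smooth_on_add[OF open_cimage[OF that] vector_field_smooth[OF assms(1) that]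
          vector_field_smooth[OF assms(2) that]])
qed (simp add: vector_field_off[OF assms(1)] vector_field_off[OF assms(2)])

lemma sec_scale_vector_field:
  assumes "smooth_scalar f" "X \<in> vector_fields M"
  shows "sec_scale f X \<in> vector_fields M"
  unfolding sec_scale_def
proof (rule vector_fieldI)
  show "(\<lambda>k. f p *\<^sub>R X p k) \<in> tangent_space M p" for p
    by (rule tangent_scale[OF vector_field_tangent[OF assms(2)]])
  show "smooth_on (cimage c) (\<lambda>x. f (cinv c x) *\<^sub>R X (cinv c x) c)" if "c \<in> atlas M" for c
  proof (rule smooth_on_scaleR[OF open_cimage[OF that] _ vector_field_smooth[OF assms(2) that]])
    show "smooth_on (cimage c) (\<lambda>x. f (cinv c x))"
      using assms(1) that by (simp add: smooth_scalar_def)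
  qed
qed (simp add: vector_field_off[OF assms(2)])

lemma zero_vector_field: "(\<lambda>_ _. 0) \<in> vector_fields M"
  by (rule vector_fieldI) (simp_all add: tangent_0 smooth_on_const)

lemma sec_add_one_form:
  assumes "\<xi> \<in> one_forms M" "\<eta> \<in> one_forms M"
  shows "sec_add \<xi> \<eta> \<in> one_forms M"
proof (rule one_formI)
  show "linear_functional_on (tangent_space M p) (sec_add \<xi> \<eta> p)" for p
    using one_form_linear[OF assms(1), of p] one_form_linear[OF assms(2), of p]
    by (simp add: linear_functional_on_def sec_add_def algebra_simps)
  show "smooth_on (cimage c) (\<lambda>x. sec_add \<xi> \<eta> (cinv c x) (coord_vec M c e (cinv c x)))"
    if "c \<in> atlas M" for c e
    unfolding sec_add_def
    by (intro smooth_on_add open_cimage one_form_smooth assms that)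
qed (simp_all add: sec_add_def one_form_off[OF assms(1)] one_form_off[OF assms(2)]
    one_form_off_tangent[OF assms(1)] one_form_off_tangent[OF assms(2)])

lemma sec_scale_one_form:
  assumes "smooth_scalar f" "\<xi> \<in> one_forms M"
  shows "sec_scale f \<xi> \<in> one_forms M"
proof (rule one_formI)
  show "linear_functional_on (tangent_space M p) (sec_scale f \<xi> p)" for p
    using one_form_linear[OF assms(2), of p]
    by (simp add: linear_functional_on_def sec_scale_def algebra_simps)
  show "smooth_on (cimage c) (\<lambda>x. sec_scale f \<xi> (cinv c x) (coord_vec M c e (cinv c x)))"
    if "c \<in> atlas M" for c e
  proof -
    have "smooth_on (cimage c) (\<lambda>x. f (cinv c x))"
      using assms(1) that by (simp add: smooth_scalar_def)
    then show ?thesis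
      unfolding sec_scale_def real_scaleR_def
      by (rule smooth_on_mult[OF open_cimage[OF that] _ one_form_smooth[OF assms(2) that]])
  qed
qed (simp_all add: sec_scale_def one_form_off[OF assms(2)] one_form_off_tangent[OF assms(2)])

lemma zero_one_form: "(\<lambda>_ _. 0) \<in> one_forms M"
  by (rule one_formI) (simp_all add: linear_functional_on_def smooth_on_const)

lemma one_form_apply_smooth:
  assumes "\<xi> \<in> one_forms M" "X \<in> vector_fields M"
  shows "(\<lambda>p. \<xi> p (X p)) \<in> smooth_functions M"
proof -
  have "smooth_on (cimage c) (\<lambda>x. \<xi> (cinv c x) (X (cinv c x)))" if c: "c \<in> atlas M" for c
  proof (rule smooth_on_transform[OF _ open_cimage[OF c]])
    show "smooth_on (cimage c) (\<lambda>x. \<Sum>i\<in>Basis.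
        (X (cinv c x) c \<bullet> i) * \<xi> (cinv c x) (coord_vec M c i (cinv c x)))"
      by (intro smooth_on_sum smooth_on_mult open_cimage[OF c] one_form_smooth[OF assms(1) c]
          smooth_on_inner smooth_on_const vector_field_smooth[OF assms(2) c])
    show "(\<Sum>i\<in>Basis. (X (cinv c x) c \<bullet> i) * \<xi> (cinv c x) (coord_vec M c i (cinv c x)))
        = \<xi> (cinv c x) (X (cinv c x))" if "x \<in> cimage c" for x
      by (rule linear_functional_expand[OF charts_at_cinv[OF c that] one_form_linear[OF assms(1)]
            vector_field_tangent[OF assms(2)], symmetric])
  qed
  then show ?thesis
    by (simp add: smooth_functions_def o_def one_form_off[OF assms(1)])
qed

text \<open>Global fields reach every tangent vector, so pairing with fields separates 1-forms. This
  provides the uniqueness behind \<open>dual_endo\<close>.\<close>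

lemma one_forms_eqI:
  assumes "\<xi> \<in> one_forms M" "\<eta> \<in> one_forms M"
    and "\<And>X p. X \<in> vector_fields M \<Longrightarrow> p \<in> points M \<Longrightarrow> \<xi> p (X p) = \<eta> p (X p)"
  shows "\<xi> = \<eta>"
proof (intro ext)
  fix p v
  consider "p \<notin> points M" | "v \<notin> tangent_space M p" | "p \<in> points M" "v \<in> tangent_space M p"
    by blast
  then show "\<xi> p v = \<eta> p v"
  proof cases
    case 3
    then show ?thesis
      using vector_field_extending assms(3) by metis
  qed (use assms(1,2) in \<open>simp_all add: one_form_off one_form_off_tangent\<close>)
qed

lemma tangent_expand:
  assumes "c \<in> charts_at M p" "v \<in> tangent_space M p"
  shows "v k = (\<Sum>i\<in>Basis. (v c \<bullet> i) *\<^sub>R coord_vec M c i p k)"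
proof -
  have "linear (\<lambda>e. coord_vec M c e p k)"
    by (intro linearI) (simp_all add: coord_vec_add coord_vec_scale assms(1))
  from linear_on_Basis[OF this, of "v c"] show ?thesis
    by (simp add: coord_vec_eq assms)
qed

section \<open>Module endomorphisms of vector fields are pointwise, and their transposes on
  1-forms\<close>

abbreviation vf_endomorphism :: "(('m, 'e) vfield \<Rightarrow> ('m, 'e) vfield) \<Rightarrow> bool" where
  "vf_endomorphism \<equiv> module_endomorphism M (vector_fields M) sec_add sec_scale"

lemma endo_closed: "vf_endomorphism F \<Longrightarrow> X \<in> vector_fields M \<Longrightarrow> F X \<in> vector_fields M"
  by (simp add: module_endomorphism_def)

lemma endo_add:
  "vf_endomorphism F \<Longrightarrow> X \<in> vector_fields M \<Longrightarrow> Y \<in> vector_fields M \<Longrightarrow>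
    F (sec_add X Y) = sec_add (F X) (F Y)"
  by (simp add: module_endomorphism_def)

text \<open>Module linearity speaks only of functions vanishing off \<open>M\<close>. Fields vanish
  there as well, so cutting a scalar off outside \<open>M\<close> changes nothing, and constants
  become admissible.\<close>

lemma endo_scale:
  assumes "vf_endomorphism F" "smooth_scalar f" "X \<in> vector_fields M"
  shows "F (sec_scale f X) = sec_scale f (F X)"
proof -
  let ?f = "\<lambda>p. if p \<in> points M then f p else 0"
  have "F (sec_scale ?f X) = sec_scale ?f (F X)"
    using assms smooth_scalar_restrict by (simp add: module_endomorphism_def)
  then show ?thesis
    using assms by (simp add: sec_scale_restrict vector_field_off endo_closed)
qed

text \<open>Membership and formula are proved together, since additivity applies to a partial sum
  only once it is known to be a field. The empty sum rests on scaling by 0.\<close>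

lemma endo_sum:
  assumes F: "vf_endomorphism F" and "finite I"
    and "\<And>i. i \<in> I \<Longrightarrow> smooth_scalar (f i)" "\<And>i. i \<in> I \<Longrightarrow> Y i \<in> vector_fields M"
  shows "(\<lambda>p k. \<Sum>i\<in>I. f i p *\<^sub>R Y i p k) \<in> vector_fields M \<and>
    F (\<lambda>p k. \<Sum>i\<in>I. f i p *\<^sub>R Y i p k) = (\<lambda>p k. \<Sum>i\<in>I. f i p *\<^sub>R F (Y i) p k)"
  using assms(2-)
proof (induction I rule: finite_induct)
  case empty
  have "F (sec_scale (\<lambda>_. 0) (\<lambda>_ _. 0)) = sec_scale (\<lambda>_. 0) (F (\<lambda>_ _. 0))"
    by (intro endo_scale F smooth_scalar_const zero_vector_field)
  then show ?case
    by (simp add: sec_scale_def zero_vector_field)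
next
  case (insert i I)
  let ?S = "\<lambda>p k. \<Sum>i\<in>I. f i p *\<^sub>R Y i p k"
  have S: "?S \<in> vector_fields M" "F ?S = (\<lambda>p k. \<Sum>i\<in>I. f i p *\<^sub>R F (Y i) p k)"
    using insert by auto
  have i: "smooth_scalar (f i)" "Y i \<in> vector_fields M"
    using insert.prems by auto
  have eq: "(\<lambda>p k. \<Sum>i\<in>insert i I. f i p *\<^sub>R Y i p k) = sec_add (sec_scale (f i) (Y i)) ?S"
    using insert.hyps by (simp add: sec_add_def sec_scale_def)
  have "F (sec_add (sec_scale (f i) (Y i)) ?S) = sec_add (sec_scale (f i) (F (Y i))) (F ?S)"
    using F i S(1) by (simp add: endo_add endo_scale sec_scale_vector_field)
  then show ?case
    unfolding eq using i S insert.hyps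
    by (simp add: sec_add_vector_field sec_scale_vector_field)
      (simp add: sec_add_def sec_scale_def)
qed

text \<open>With a bump function \<open>h\<close> supported in a chart, \<open>h\<^sup>2 X = \<Sum>i. (h X\<^sup>i) (h \<partial>\<^sub>i)\<close> is a global identity.\<close>

lemma endo_tensorial_zero:
  assumes F: "vf_endomorphism F" and X: "X \<in> vector_fields M" and p: "p \<in> points M"
    and X0: "X p = (\<lambda>_. 0)"
  shows "F X p = (\<lambda>_. 0)"
proof -
  obtain c where c: "c \<in> charts_at M p"
    using charts_at_cover p by blast
  have ca: "c \<in> atlas M" "p \<in> fst c"
    using charts_atD[OF c] by auto
  obtain \<phi> :: "'e \<Rightarrow> real" and K where \<phi>: "compact K" "K \<subseteq> cimage c" "smooth_on UNIV \<phi>"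
    "\<And>x. x \<notin> K \<Longrightarrow> \<phi> x = 0" "\<phi> (snd c p) \<noteq> 0"
    using chart_bump[OF c] by metis
  have \<phi>': "smooth_on (cimage c) \<phi>"
    using smooth_on_subset[OF \<phi>(3)] by simp
  define h where "h = chart_fun c \<phi>"
  define f where "f i = chart_fun c (\<lambda>x. \<phi> x * (X (cinv c x) c \<bullet> i))" for i
  have h: "smooth_scalar h"
    unfolding h_def
    by (rule smooth_scalar_smooth_function[OF chart_fun_smooth[OF ca(1) \<phi>(1,2) \<phi>' \<phi>(4)]])
  have f: "smooth_scalar (f i)" for i
    unfolding f_def
    by (intro smooth_scalar_smooth_function chart_fun_smooth[OF ca(1) \<phi>(1,2)] smooth_on_mult \<phi>'
        smooth_on_inner vector_field_smooth[OF X] smooth_on_const ca open_cimage)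
      (simp add: \<phi>(4))
  have Y: "chart_field c \<phi> i \<in> vector_fields M" for i
    by (rule chart_field_vector_field[OF ca(1) \<phi>(1,2) \<phi>' \<phi>(4)])
  have "sec_scale h (sec_scale h X) = (\<lambda>q k. \<Sum>i\<in>Basis. f i q *\<^sub>R chart_field c \<phi> i q k)"
  proof (intro ext)
    fix q k
    show "sec_scale h (sec_scale h X) q k = (\<Sum>i\<in>Basis. f i q *\<^sub>R chart_field c \<phi> i q k)"
    proof (cases "q \<in> fst c")
      case True
      then have "c \<in> charts_at M q"
        using ca by (simp add: charts_at_def)
      note expand = tangent_expand[OF this vector_field_tangent[OF X], of k]
      have "sec_scale h (sec_scale h X) q k = (h q * h q) *\<^sub>R X q k"
        by (simp add: sec_scale_def)
      also have "\<dots> = (\<Sum>i\<in>Basis. (h q * h q) *\<^sub>R ((X q c \<bullet> i) *\<^sub>R coord_vec M c i q k))"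
        by (subst expand) (rule scaleR_sum_right)
      also have "\<dots> = (\<Sum>i\<in>Basis. f i q *\<^sub>R chart_field c \<phi> i q k)"
        using True ca by (simp add: h_def f_def chart_field_def chart_fun_def mult_ac)
      finally show ?thesis .
    qed (simp add: sec_scale_def h_def f_def chart_fun_def)
  qed
  then have "F (sec_scale h (sec_scale h X)) = (\<lambda>q k. \<Sum>i\<in>Basis. f i q *\<^sub>R F (chart_field c \<phi> i) q k)"
    using endo_sum[where I = Basis and f = f and Y = "chart_field c \<phi>", OF F finite_Basis f Y] by simp
  moreover have "F (sec_scale h (sec_scale h X)) = sec_scale h (sec_scale h (F X))"
    using F h X by (simp add: endo_scale sec_scale_vector_field)
  \<comment> \<open>At \<open>p\<close> every coefficient \<open>f i\<close> contains a component of
    \<open>X p\<close> and so vanishes, while the square of \<open>h\<close> on the left does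
    not.\<close>
  ultimately have "sec_scale h (sec_scale h (F X)) p k =
      (\<Sum>i\<in>Basis. f i p *\<^sub>R F (chart_field c \<phi> i) p k)" for k
    by simp
  moreover have "f i p = 0" for i
    using ca X0 by (simp add: f_def chart_fun_def)
  moreover have "h p \<noteq> 0"
    using ca \<phi>(5) by (simp add: h_def chart_fun_def)
  ultimately show ?thesis
    by (simp add: sec_scale_def fun_eq_iff)
qed

lemma endo_tensorial:
  assumes F: "vf_endomorphism F" and X: "X \<in> vector_fields M" and Y: "Y \<in> vector_fields M"
    and p: "p \<in> points M" and eq: "X p = Y p"
  shows "F X p = F Y p"
proof -
  have Y': "sec_scale (\<lambda>_. -1) Y \<in> vector_fields M"
    by (intro sec_scale_vector_field smooth_scalar_const Y)
  have "F (sec_add X (sec_scale (\<lambda>_. -1) Y)) p = (\<lambda>_. 0)"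
    using eq by (intro endo_tensorial_zero[OF F _ p] sec_add_vector_field X Y')
      (simp add: sec_add_def sec_scale_def)
  then show ?thesis
    using F X Y Y' by (simp add: endo_add endo_scale smooth_scalar_const)
      (simp add: sec_add_def sec_scale_def fun_eq_iff)
qed

text \<open>The value on a tangent vector is read off from any global field through it, and
  tensoriality makes the result independent of the field. Smoothness is then checked on coordinate
  fields cut off by bump functions.\<close>

lemma dual_endo_exists:
  assumes F: "vf_endomorphism F" and \<xi>: "\<xi> \<in> one_forms M"
  obtains \<zeta> where "\<zeta> \<in> one_forms M"
    "\<And>X p. X \<in> vector_fields M \<Longrightarrow> p \<in> points M \<Longrightarrow> \<zeta> p (X p) = \<xi> p (F X p)"
proof -
  \<comment> \<open>The choices at different points are unrelated, so smoothness of
    \<open>\<zeta>\<close> cannot be inherited from \<open>ext\<close>.\<close>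
  define ext where "ext p v = (SOME X. X \<in> vector_fields M \<and> X p = v)" for p v
  have ext: "ext p v \<in> vector_fields M" "ext p v p = v"
    if "p \<in> points M" "v \<in> tangent_space M p" for p v
  proof -
    have "\<exists>X. X \<in> vector_fields M \<and> X p = v"
      using vector_field_extending[OF that] by metis
    from someI_ex[OF this] show "ext p v \<in> vector_fields M" "ext p v p = v"
      by (simp_all add: ext_def)
  qed
  define \<zeta> where "\<zeta> p v = (if p \<in> points M \<and> v \<in> tangent_space M p
    then \<xi> p (F (ext p v) p) else 0)" for p v
  have \<zeta>: "\<zeta> p (X p) = \<xi> p (F X p)" if "X \<in> vector_fields M" "p \<in> points M" for X p
    using that vector_field_tangent[OF that(1), of p] ext[of p "X p"]
      endo_tensorial[OF F, of "ext p (X p)" X p] by (simp add: \<zeta>_def)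
  have lin: "linear_functional_on (tangent_space M p) (\<zeta> p)" if p: "p \<in> points M" for p
    unfolding linear_functional_on_def
  proof (intro conjI allI ballI)
    fix v w assume v: "v \<in> tangent_space M p" and w: "w \<in> tangent_space M p"
    let ?V = "ext p v" and ?W = "ext p w"
    have V: "?V \<in> vector_fields M" "?W \<in> vector_fields M"
      using ext p v w by auto
    have "\<zeta> p (sec_add ?V ?W p) = \<xi> p (sec_add (F ?V) (F ?W) p)"
      using \<zeta>[OF sec_add_vector_field[OF V] p] by (simp add: endo_add[OF F V])
    also have "\<dots> = \<xi> p (F ?V p) + \<xi> p (F ?W p)"
      using \<xi> V F by (simp add: sec_add_def one_form_add vector_field_tangent endo_closed)
    finally show "\<zeta> p (\<lambda>k. v k + w k) = \<zeta> p v + \<zeta> p w"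
      using ext p v w by (simp add: sec_add_def \<zeta>_def)
  next
    fix r v assume v: "v \<in> tangent_space M p"
    let ?V = "ext p v"
    have V: "?V \<in> vector_fields M"
      using ext p v by auto
    have "\<zeta> p (sec_scale (\<lambda>_. r) ?V p) = \<xi> p (sec_scale (\<lambda>_. r) (F ?V) p)"
      using \<zeta>[OF sec_scale_vector_field[OF smooth_scalar_const V] p]
      by (simp add: endo_scale[OF F smooth_scalar_const V])
    also have "\<dots> = r * \<xi> p (F ?V p)"
      using \<xi> V F by (simp add: sec_scale_def one_form_scale vector_field_tangent endo_closed)
    finally show "\<zeta> p (\<lambda>k. r *\<^sub>R v k) = r * \<zeta> p v"
      using ext p v by (simp add: sec_scale_def \<zeta>_def)
  qed
  have "smooth_on (cimage c) (\<lambda>x. \<zeta> (cinv c x) (coord_vec M c e (cinv c x)))"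
    if ca: "c \<in> atlas M" for c e
  proof (rule smooth_on_open_cover)
    fix x assume x: "x \<in> cimage c"
    obtain \<phi> :: "'e \<Rightarrow> real" and K where \<phi>: "compact K" "K \<subseteq> cimage c" "smooth_on UNIV \<phi>"
      "\<And>x. x \<notin> K \<Longrightarrow> \<phi> x = 0" "\<phi> (snd c (cinv c x)) \<noteq> 0" "open {x. \<phi> x \<noteq> 0}"
      using chart_bump[OF charts_at_cinv[OF ca x]] by metis
    let ?T = "cimage c \<inter> {x. \<phi> x \<noteq> 0}" and ?Y = "chart_field c \<phi> e"
    have T: "open ?T"
      using open_cimage[OF ca] \<phi>(6) by blast
    have Y: "?Y \<in> vector_fields M"
      using chart_field_vector_field[OF ca \<phi>(1,2) smooth_on_subset[OF \<phi>(3)] \<phi>(4)] by simp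
    have "smooth_on (cimage c) (\<lambda>y. \<xi> (cinv c y) (F ?Y (cinv c y)))"
      using one_form_apply_smooth[OF \<xi> endo_closed[OF F Y]] ca
      by (simp add: smooth_functions_def o_def)
    then have "smooth_on ?T (\<lambda>y. \<xi> (cinv c y) (F ?Y (cinv c y)))"
      by (rule smooth_on_subset) simp
    \<comment> \<open>One fixed global field \<open>?Y\<close> serves all points of
      \<open>?T\<close> at once; its value is \<open>\<phi> y\<close> times the coordinate vector,
      so linearity of \<open>\<zeta>\<close> at each point pulls out a smooth factor, which is then
      divided away.\<close>
    then have "smooth_on ?T (\<lambda>y. \<phi> y * \<zeta> (cinv c y) (coord_vec M c e (cinv c y)))"
    proof (rule smooth_on_transform[OF _ T])
      show "\<xi> (cinv c y) (F ?Y (cinv c y)) = \<phi> y * \<zeta> (cinv c y) (coord_vec M c e (cinv c y))"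
        if "y \<in> ?T" for y
      proof -
        have y: "y \<in> cimage c"
          using that by simp
        note cy = charts_at_cinv[OF ca y]
        have "\<zeta> (cinv c y) (?Y (cinv c y)) = \<phi> y * \<zeta> (cinv c y) (coord_vec M c e (cinv c y))"
          using lin[OF charts_at_points[OF cy]] coord_vec_tangent[OF cy] y
          by (simp add: chart_field_def chart_fun_def linear_functional_on_def)
        then show ?thesis
          using \<zeta>[OF Y charts_at_points[OF cy]] by simp
      qed
    qed
    then have "smooth_on ?T (\<lambda>x. \<zeta> (cinv c x) (coord_vec M c e (cinv c x)))"
      by (rule smooth_on_cancel_mult[OF T _ smooth_on_subset[OF \<phi>(3) subset_UNIV], rotated]) simp
    then show "\<exists>T. open T \<and> x \<in> T \<and> T \<subseteq> cimage c \<and>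
        smooth_on T (\<lambda>x. \<zeta> (cinv c x) (coord_vec M c e (cinv c x)))"
      using T x \<phi>(5) by (intro exI[of _ ?T]) auto
  qed
  then have "\<zeta> \<in> one_forms M"
    using lin by (intro one_formI) (auto simp: \<zeta>_def)
  then show ?thesis
    using \<zeta> that by blast
qed

lemma dual_endo:
  assumes "vf_endomorphism F" "\<xi> \<in> one_forms M"
  shows "dual_endo M F \<xi> \<in> one_forms M"
    and "X \<in> vector_fields M \<Longrightarrow> p \<in> points M \<Longrightarrow> dual_endo M F \<xi> p (X p) = \<xi> p (F X p)"
proof -
  let ?P = "\<lambda>\<zeta>. \<zeta> \<in> one_forms M \<and>
     (\<forall>X\<in>vector_fields M. \<forall>p\<in>points M. \<zeta> p (X p) = \<xi> p (F X p))"
  obtain \<zeta> where \<zeta>: "?P \<zeta>"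
    using dual_endo_exists[OF assms] by metis
  have "?P (dual_endo M F \<xi>)"
    unfolding dual_endo_def
  proof (rule theI[of ?P, OF \<zeta>])
    show "\<eta> = \<zeta>" if "?P \<eta>" for \<eta>
      using that \<zeta> by (intro one_forms_eqI) auto
  qed
  then show "dual_endo M F \<xi> \<in> one_forms M"
    "X \<in> vector_fields M \<Longrightarrow> p \<in> points M \<Longrightarrow> dual_endo M F \<xi> p (X p) = \<xi> p (F X p)"
    by blast+
qed

end

section \<open>Musical isomorphisms\<close>

locale nondegenerate_mfd = smooth_mfd +
  fixes g :: "('a, 'b) tensor2"
  assumes symmetric_g: "symmetric_2tensor M g" and nondegenerate_g: "nondegenerate M g"
begin

lemma g_linear:
  "p \<in> points M \<Longrightarrow> v \<in> tangent_space M p \<Longrightarrow> linear_functional_on (tangent_space M p) (g p v)"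
  using symmetric_g unfolding symmetric_2tensor_def by blast

lemma g_commute:
  "p \<in> points M \<Longrightarrow> v \<in> tangent_space M p \<Longrightarrow> w \<in> tangent_space M p \<Longrightarrow> g p v w = g p w v"
  using symmetric_g unfolding symmetric_2tensor_def by blast

lemma g_smooth:
  "c \<in> atlas M \<Longrightarrow> smooth_on (cimage c)
    (\<lambda>x. g (cinv c x) (coord_vec M c e (cinv c x)) (coord_vec M c e' (cinv c x)))"
  using symmetric_g unfolding symmetric_2tensor_def by blast

lemma g_add_right:
  "p \<in> points M \<Longrightarrow> v \<in> tangent_space M p \<Longrightarrow> a \<in> tangent_space M p \<Longrightarrow> b \<in> tangent_space M p \<Longrightarrow>
    g p v (\<lambda>k. a k + b k) = g p v a + g p v b"
  using g_linear unfolding linear_functional_on_def by blast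

lemma g_scale_right:
  "p \<in> points M \<Longrightarrow> v \<in> tangent_space M p \<Longrightarrow> a \<in> tangent_space M p \<Longrightarrow>
    g p v (\<lambda>k. r *\<^sub>R a k) = r * g p v a"
  using g_linear unfolding linear_functional_on_def by blast

lemma g_add_left:
  "p \<in> points M \<Longrightarrow> v \<in> tangent_space M p \<Longrightarrow> a \<in> tangent_space M p \<Longrightarrow> b \<in> tangent_space M p \<Longrightarrow>
    g p (\<lambda>k. a k + b k) v = g p a v + g p b v"
  using g_add_right[of p v a b] by (simp add: g_commute[of p _ v] tangent_add)

lemma g_scale_left:
  "p \<in> points M \<Longrightarrow> v \<in> tangent_space M p \<Longrightarrow> a \<in> tangent_space M p \<Longrightarrow>
    g p (\<lambda>k. r *\<^sub>R a k) v = r * g p a v"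
  using g_scale_right[of p v a r] by (simp add: g_commute[of p _ v] tangent_scale)

lemma tangent_eqI:
  assumes p: "p \<in> points M" and v: "v \<in> tangent_space M p" and w: "w \<in> tangent_space M p"
    and eq: "\<And>u. u \<in> tangent_space M p \<Longrightarrow> g p v u = g p w u"
  shows "v = w"
proof -
  have w': "(\<lambda>k. (-1) *\<^sub>R w k) \<in> tangent_space M p"
    by (rule tangent_scale[OF w])
  have "g p (\<lambda>k. v k + (-1) *\<^sub>R w k) u = 0" if u: "u \<in> tangent_space M p" for u
    by (simp only: g_add_left[OF p u v w'] g_scale_left[OF p u w] eq[OF u])
  then have "(\<lambda>k. v k + (-1) *\<^sub>R w k) = (\<lambda>_. 0)"
    using nondegenerate_g p tangent_add[OF v w'] unfolding nondegenerate_def by blast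
  then show ?thesis
    by (simp add: fun_eq_iff)
qed

lemma vector_fields_eqI:
  assumes X: "X \<in> vector_fields M" and Y: "Y \<in> vector_fields M"
    and eq: "\<And>p w. p \<in> points M \<Longrightarrow> w \<in> tangent_space M p \<Longrightarrow> g p (X p) w = g p (Y p) w"
  shows "X = Y"
proof
  fix p
  show "X p = Y p"
  proof (cases "p \<in> points M")
    case True
    then show ?thesis
      using tangent_eqI[OF True vector_field_tangent[OF X] vector_field_tangent[OF Y]] eq by blast
  qed (simp add: vector_field_off[OF X] vector_field_off[OF Y])
qed

lemma flat_apply:
  "p \<in> points M \<Longrightarrow> v \<in> tangent_space M p \<Longrightarrow> flat M g X p v = g p (X p) v"
  by (simp add: flat_def)

lemma flat_one_form:
  assumes X: "X \<in> vector_fields M"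
  shows "flat M g X \<in> one_forms M"
proof (rule one_formI)
  show "linear_functional_on (tangent_space M p) (flat M g X p)" if p: "p \<in> points M" for p
    using g_linear[OF p vector_field_tangent[OF X]]
    by (simp add: linear_functional_on_def flat_apply p tangent_add tangent_scale)
  show "smooth_on (cimage c) (\<lambda>x. flat M g X (cinv c x) (coord_vec M c e (cinv c x)))"
    if c: "c \<in> atlas M" for c e
  proof (rule smooth_on_transform[OF _ open_cimage[OF c]])
    show "smooth_on (cimage c) (\<lambda>x. \<Sum>i\<in>Basis. (X (cinv c x) c \<bullet> i) *
        g (cinv c x) (coord_vec M c e (cinv c x)) (coord_vec M c i (cinv c x)))"
      by (intro smooth_on_sum smooth_on_mult open_cimage[OF c] g_smooth[OF c]
          smooth_on_inner smooth_on_const vector_field_smooth[OF X c])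
    show "(\<Sum>i\<in>Basis. (X (cinv c x) c \<bullet> i) *
        g (cinv c x) (coord_vec M c e (cinv c x)) (coord_vec M c i (cinv c x)))
      = flat M g X (cinv c x) (coord_vec M c e (cinv c x))" if x: "x \<in> cimage c" for x
    proof -
      note cx = charts_at_cinv[OF c x]
      note px = charts_at_points[OF cx] and ex = coord_vec_tangent[OF cx]
      show ?thesis
        using linear_functional_expand[OF cx g_linear[OF px ex] vector_field_tangent[OF X]]
        by (simp add: flat_apply[OF px ex] g_commute[OF px vector_field_tangent[OF X] ex])
    qed
  qed
qed (simp_all add: flat_def)

lemma flat_inj_on: "inj_on (flat M g) (vector_fields M)"
proof (rule inj_onI)
  fix X Y assume "X \<in> vector_fields M" "Y \<in> vector_fields M" "flat M g X = flat M g Y"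
  then show "X = Y"
    using flat_apply by (intro vector_fields_eqI) metis+
qed

text \<open>The Gram matrix of \<open>g\<close> in the chart, written as an endomorphism of the
  model space so that the results on linear systems apply directly.\<close>

definition gram :: "('a, 'b) chart \<Rightarrow> 'a \<Rightarrow> 'b \<Rightarrow> 'b" where
  "gram c p e = (\<Sum>j\<in>Basis. g p (coord_vec M c e p) (coord_vec M c j p) *\<^sub>R j)"

lemma gram_linear:
  assumes c: "c \<in> charts_at M p"
  shows "linear (gram c p)"
proof -
  note p = charts_at_points[OF c] and t = coord_vec_tangent[OF c]
  show ?thesis
  proof (rule linearI)
    show "gram c p (a + b) = gram c p a + gram c p b" for a b
      by (simp add: gram_def coord_vec_add[OF c] g_add_left[OF p t t t] scaleR_add_left
          sum.distrib)
    show "gram c p (r *\<^sub>R a) = r *\<^sub>R gram c p a" for r a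
      by (simp add: gram_def coord_vec_scale[OF c] g_scale_left[OF p t t] scaleR_sum_right)
  qed
qed

text \<open>Functionals on the tangent space are determined by their values on the coordinate basis.
  Thus inverting the musical map at \<open>p\<close> is the same as solving a Gram system whose
  right-hand side lists the components of \<open>l\<close>.\<close>

lemma gram_eq_iff:
  assumes c: "c \<in> charts_at M p" and l: "linear_functional_on (tangent_space M p) l"
  shows "gram c p e = (\<Sum>j\<in>Basis. l (coord_vec M c j p) *\<^sub>R j) \<longleftrightarrow>
    (\<forall>w\<in>tangent_space M p. g p (coord_vec M c e p) w = l w)"
proof
  assume "gram c p e = (\<Sum>j\<in>Basis. l (coord_vec M c j p) *\<^sub>R j)"
  then have inner: "gram c p e \<bullet> j = (\<Sum>j\<in>Basis. l (coord_vec M c j p) *\<^sub>R j) \<bullet> j" for j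
    by simp
  have eq: "g p (coord_vec M c e p) (coord_vec M c j p) = l (coord_vec M c j p)"
    if "j \<in> Basis" for j
    using inner[of j] that by (simp add: gram_def)
  show "\<forall>w\<in>tangent_space M p. g p (coord_vec M c e p) w = l w"
  proof
    fix w assume w: "w \<in> tangent_space M p"
    show "g p (coord_vec M c e p) w = l w"
      unfolding linear_functional_expand[OF c l w]
        linear_functional_expand[OF c g_linear[OF charts_at_points[OF c] coord_vec_tangent[OF c]] w]
      by (rule sum.cong) (simp_all add: eq)
  qed
qed (simp add: gram_def coord_vec_tangent[OF c])

lemma gram_inj:
  assumes c: "c \<in> charts_at M p"
  shows "inj (gram c p)"
  unfolding linear_injective_0[OF gram_linear[OF c]]
proof (intro allI impI)
  fix e assume "gram c p e = 0"
  then have "\<forall>w\<in>tangent_space M p. g p (coord_vec M c e p) w = 0"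
    using gram_eq_iff[OF c, of "\<lambda>_. 0" e] by (simp add: linear_functional_on_def)
  then have "coord_vec M c e p = (\<lambda>_. 0)"
    using nondegenerate_g charts_at_points[OF c] coord_vec_tangent[OF c]
    unfolding nondegenerate_def by blast
  then show "e = 0"
    using coord_vec_self[OF c, of e] by simp
qed

text \<open>At each point an injective endomorphism of a finite-dimensional space is onto, which
  gives the vector; smooth dependence of solutions then assembles the vectors into a field.\<close>

lemma flat_surj:
  assumes \<xi>: "\<xi> \<in> one_forms M"
  obtains X where "X \<in> vector_fields M" "flat M g X = \<xi>"
proof -
  have ex: "\<exists>v. v \<in> tangent_space M p \<and> (\<forall>w\<in>tangent_space M p. g p v w = \<xi> p w)"
    if p: "p \<in> points M" for p
  proof -
    obtain c where c: "c \<in> charts_at M p"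
      using charts_at_cover p by blast
    have "surj (gram c p)"
      using linear_injective_imp_surjective[OF gram_linear[OF c] gram_inj[OF c]] by simp
    then obtain e where "gram c p e = (\<Sum>j\<in>Basis. \<xi> p (coord_vec M c j p) *\<^sub>R j)"
      by (metis surjD)
    then show ?thesis
      using gram_eq_iff[OF c one_form_linear[OF \<xi>]] coord_vec_tangent[OF c] by blast
  qed
  define X where "X p = (if p \<in> points M
    then SOME v. v \<in> tangent_space M p \<and> (\<forall>w\<in>tangent_space M p. g p v w = \<xi> p w)
    else (\<lambda>_. 0))" for p
  have X: "X p \<in> tangent_space M p" "w \<in> tangent_space M p \<Longrightarrow> g p (X p) w = \<xi> p w"
    if "p \<in> points M" for p w
    using someI_ex[OF ex[OF that]] that by (simp_all add: X_def)
  have vf: "X \<in> vector_fields M"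
  proof (rule vector_fieldI)
    show "smooth_on (cimage c) (\<lambda>x. X (cinv c x) c)" if c: "c \<in> atlas M" for c
    \<comment> \<open>Although \<open>X\<close> was chosen point by point, its components in every
      chart solve a system with smooth, invertible coefficients.\<close>
    proof (rule smooth_on_linear_solve[where G = "\<lambda>x. gram c (cinv c x)"
          and b = "\<lambda>x. \<Sum>j\<in>Basis. \<xi> (cinv c x) (coord_vec M c j (cinv c x)) *\<^sub>R j"])
      show "smooth_on (cimage c) (\<lambda>x. gram c (cinv c x) e)" for e
        unfolding gram_def
        by (intro smooth_on_sum smooth_on_scaleR smooth_on_const open_cimage[OF c] g_smooth[OF c])
      show "smooth_on (cimage c)
          (\<lambda>x. \<Sum>j\<in>Basis. \<xi> (cinv c x) (coord_vec M c j (cinv c x)) *\<^sub>R j)"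
        by (intro smooth_on_sum smooth_on_scaleR smooth_on_const open_cimage[OF c]
            one_form_smooth[OF \<xi> c])
      fix x assume "x \<in> cimage c"
      note cx = charts_at_cinv[OF c this]
      show "linear (gram c (cinv c x))" "inj (gram c (cinv c x))"
        by (rule gram_linear[OF cx], rule gram_inj[OF cx])
      note px = charts_at_points[OF cx]
      have "\<forall>w\<in>tangent_space M (cinv c x). g (cinv c x) (X (cinv c x)) w = \<xi> (cinv c x) w"
        using X(2)[OF px] by blast
      then show "gram c (cinv c x) (X (cinv c x) c) =
          (\<Sum>j\<in>Basis. \<xi> (cinv c x) (coord_vec M c j (cinv c x)) *\<^sub>R j)"
        unfolding gram_eq_iff[OF cx one_form_linear[OF \<xi>]] coord_vec_eq[OF cx X(1)[OF px]] .
    qed (rule open_cimage[OF c])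
  qed (use X(1) in \<open>simp_all add: X_def\<close>)
  moreover have "flat M g X = \<xi>"
  proof (rule one_forms_eqI[OF flat_one_form[OF vf] \<xi>])
    show "flat M g X p (Y p) = \<xi> p (Y p)" if "Y \<in> vector_fields M" "p \<in> points M" for Y p
      by (simp add: flat_apply X(2) that vector_field_tangent[OF that(1)])
  qed
  ultimately show ?thesis
    by (rule that)
qed

lemma sharp_vector_field: "\<xi> \<in> one_forms M \<Longrightarrow> sharp M g \<xi> \<in> vector_fields M"
  and flat_sharp: "\<xi> \<in> one_forms M \<Longrightarrow> flat M g (sharp M g \<xi>) = \<xi>"
proof -
  assume "\<xi> \<in> one_forms M"
  then obtain X where "X \<in> vector_fields M" "flat M g X = \<xi>"
    using flat_surj by blast
  then show "sharp M g \<xi> \<in> vector_fields M" "flat M g (sharp M g \<xi>) = \<xi>"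
    using the_inv_into_f_f[OF flat_inj_on] by (auto simp: sharp_def)
qed

lemma sharp_flat: "X \<in> vector_fields M \<Longrightarrow> sharp M g (flat M g X) = X"
  using the_inv_into_f_f[OF flat_inj_on] by (simp add: sharp_def)

lemma g_sharp:
  "\<xi> \<in> one_forms M \<Longrightarrow> p \<in> points M \<Longrightarrow> v \<in> tangent_space M p \<Longrightarrow> g p (sharp M g \<xi> p) v = \<xi> p v"
  using flat_sharp[of \<xi>] flat_apply[of p v "sharp M g \<xi>"] by simp

lemma flat_add:
  assumes X: "X \<in> vector_fields M" and Y: "Y \<in> vector_fields M"
  shows "flat M g (sec_add X Y) = sec_add (flat M g X) (flat M g Y)"
  by (intro ext)
    (simp add: flat_def sec_add_def g_add_left vector_field_tangent[OF X] vector_field_tangent[OF Y])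

lemma flat_scale:
  assumes X: "X \<in> vector_fields M"
  shows "flat M g (sec_scale f X) = sec_scale f (flat M g X)"
  by (intro ext) (simp add: flat_def sec_scale_def g_scale_left vector_field_tangent[OF X])

lemma sharp_add:
  assumes "\<xi> \<in> one_forms M" "\<eta> \<in> one_forms M"
  shows "sharp M g (sec_add \<xi> \<eta>) = sec_add (sharp M g \<xi>) (sharp M g \<eta>)"
  using sharp_flat[OF sec_add_vector_field[OF assms[THEN sharp_vector_field]]]
  by (simp add: flat_add assms sharp_vector_field flat_sharp)

lemma sharp_scale:
  assumes "smooth_scalar f" "\<xi> \<in> one_forms M"
  shows "sharp M g (sec_scale f \<xi>) = sec_scale f (sharp M g \<xi>)"
  using sharp_flat[OF sec_scale_vector_field[OF assms(1) sharp_vector_field[OF assms(2)]]]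
  by (simp add: flat_scale assms sharp_vector_field flat_sharp)

section \<open>The natural pairing as a generalized metric, and nonvanishing of
  \<open>g\<close>\<close>

lemma gen_metric_natural: "gen_metric M natural_metric"
  unfolding gen_metric_def
proof (intro conjI ballI impI)
  fix u v assume uv: "u \<in> gsections M" "v \<in> gsections M"
  then have uv': "fst u \<in> vector_fields M" "snd u \<in> one_forms M"
    "fst v \<in> vector_fields M" "snd v \<in> one_forms M"
    by (auto simp: gsections_def)
  let ?a = "\<lambda>p. snd u p (fst v p)" and ?b = "\<lambda>p. snd v p (fst u p)"
  have "?a \<in> smooth_functions M" "?b \<in> smooth_functions M"
    using one_form_apply_smooth uv' by auto
  then have "smooth_on (cimage c) (\<lambda>x. 1 / 2 * (?a (cinv c x) + ?b (cinv c x)))"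
    if "c \<in> atlas M" for c
    using that by (intro smooth_on_mult smooth_on_const smooth_on_add open_cimage)
      (simp_all add: smooth_functions_def o_def)
  then show "natural_metric u v \<in> smooth_functions M"
    by (simp add: smooth_functions_def natural_metric_def o_def one_form_off[OF uv'(2)]
        one_form_off[OF uv'(4)])
  show "natural_metric u v = natural_metric v u"
    by (simp add: natural_metric_def add.commute)
  show "natural_metric (gscale f u) v = (\<lambda>p. f p * natural_metric u v p)" for f
    using vector_field_tangent[OF uv'(1)]
    by (simp add: natural_metric_def gscale_def sec_scale_def one_form_scale[OF uv'(4)]
        fun_eq_iff algebra_simps)
  fix w assume w: "w \<in> gsections M"
  then have w': "snd w \<in> one_forms M"
    by (auto simp: gsections_def)
  show "natural_metric (gadd u v) w = (\<lambda>p. natural_metric u w p + natural_metric v w p)"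
    using vector_field_tangent[OF uv'(1)] vector_field_tangent[OF uv'(3)]
    by (simp add: natural_metric_def gadd_def sec_add_def one_form_add[OF w'] fun_eq_iff
        algebra_simps)
next
  fix p u assume p: "p \<in> points M" and "u \<in> gsections M"
    and 0: "\<forall>v\<in>gsections M. natural_metric u v p = 0"
  then have u: "fst u \<in> vector_fields M" "snd u \<in> one_forms M"
    by (auto simp: gsections_def)
  \<comment> \<open>Test 1-forms are obtained as images of fields under \<open>flat\<close>, so
    nondegeneracy of \<open>g\<close> already separates the vector part, without constructing
    covector fields by hand.\<close>
  have "g p (fst u p) w = 0" if w: "w \<in> tangent_space M p" for w
  proof -
    obtain Y where Y: "Y \<in> vector_fields M" "Y p = w"
      using vector_field_extending[OF p w] by metis
    have "((\<lambda>_ _. 0), flat M g Y) \<in> gsections M"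
      by (simp add: gsections_def zero_vector_field flat_one_form[OF Y(1)])
    from bspec[OF 0 this] have "snd u p (\<lambda>_. 0) + g p w (fst u p) = 0"
      using Y by (simp add: natural_metric_def flat_apply p vector_field_tangent[OF u(1)])
    moreover have "snd u p (\<lambda>_. 0) = 0"
      using one_form_scale[OF u(2) tangent_0, of p 0] by simp
    ultimately show ?thesis
      using g_commute[OF p w vector_field_tangent[OF u(1)]] by simp
  qed
  then show "fst u p = (\<lambda>_. 0)"
    using nondegenerate_g p vector_field_tangent[OF u(1)] unfolding nondegenerate_def by blast
  have "snd u p w = 0" if w: "w \<in> tangent_space M p" for w
  proof -
    obtain Y where Y: "Y \<in> vector_fields M" "Y p = w"
      using vector_field_extending[OF p w] by metis
    have "(Y, (\<lambda>_ _. 0)) \<in> gsections M"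
      by (simp add: gsections_def zero_one_form Y(1))
    from bspec[OF 0 this] show ?thesis
      using Y by (simp add: natural_metric_def)
  qed
  then show "snd u p = (\<lambda>_. 0)"
    using one_form_off_tangent[OF u(2)] by (intro ext) blast
qed

text \<open>Positive dimension supplies a nonzero vector and nondegeneracy a partner for it. Such a
  pair is the witness whenever a scalar factor has to be cancelled.\<close>

lemma g_nonzero:
  assumes p: "p \<in> points M"
  obtains X Y where "X \<in> vector_fields M" "Y \<in> vector_fields M" "g p (X p) (Y p) \<noteq> 0"
proof -
  obtain c where c: "c \<in> charts_at M p"
    using charts_at_cover p by blast
  obtain e :: 'b where e: "e \<noteq> 0"
    using nonzero_Basis nonempty_Basis by blast
  let ?v = "coord_vec M c e p"
  have "?v \<noteq> (\<lambda>_. 0)"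
    using coord_vec_self[OF c, of e] e by metis
  then obtain w where w: "w \<in> tangent_space M p" "g p ?v w \<noteq> 0"
    using nondegenerate_g p coord_vec_tangent[OF c] unfolding nondegenerate_def by blast
  obtain X Y where "X \<in> vector_fields M" "X p = ?v" "Y \<in> vector_fields M" "Y p = w"
    using vector_field_extending[OF p coord_vec_tangent[OF c]] vector_field_extending[OF p w(1)]
    by metis
  then show ?thesis
    using that w(2) by metis
qed

end


section \<open>The structure \<open>J\<close>\<close>

locale almost_product_mfd = nondegenerate_mfd +
  fixes F :: "('a, 'b) vfield \<Rightarrow> ('a, 'b) vfield" and \<epsilon> :: real
  assumes endo_F: "vf_endomorphism F"
    and F_F: "\<And>X. X \<in> vector_fields M \<Longrightarrow> F (F X) = X"
    and g_F_F: "\<And>X Y p. X \<in> vector_fields M \<Longrightarrow> Y \<in> vector_fields M \<Longrightarrow> p \<in> points M \<Longrightarrow>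
      g p (F X p) (F Y p) = \<epsilon> * g p (X p) (Y p)"
    and eps: "\<epsilon> = 1 \<or> \<epsilon> = -1"
begin

lemma g_F:
  "X \<in> vector_fields M \<Longrightarrow> Y \<in> vector_fields M \<Longrightarrow> p \<in> points M \<Longrightarrow>
    g p (F X p) (Y p) = \<epsilon> * g p (X p) (F Y p)"
  using g_F_F[of X "F Y" p] by (simp add: F_F endo_closed[OF endo_F])

lemma eps_square: "\<epsilon> * \<epsilon> = 1"
  using eps by auto

lemmas dual_one_form = dual_endo(1)[OF endo_F]
  and dual_apply = dual_endo(2)[OF endo_F]
  and F_closed = endo_closed[OF endo_F]

lemma dual_add:
  assumes "\<xi> \<in> one_forms M" "\<eta> \<in> one_forms M"
  shows "dual_endo M F (sec_add \<xi> \<eta>) = sec_add (dual_endo M F \<xi>) (dual_endo M F \<eta>)"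
  using assms
  by (intro one_forms_eqI dual_one_form sec_add_one_form)
    (simp_all add: dual_apply sec_add_one_form, simp_all add: sec_add_def dual_apply)

lemma dual_scale:
  assumes "smooth_scalar f" "\<xi> \<in> one_forms M"
  shows "dual_endo M F (sec_scale f \<xi>) = sec_scale f (dual_endo M F \<xi>)"
  using assms
  by (intro one_forms_eqI dual_one_form sec_scale_one_form)
    (simp_all add: dual_apply sec_scale_one_form, simp_all add: sec_scale_def dual_apply)

lemma dual_dual:
  assumes "\<xi> \<in> one_forms M"
  shows "dual_endo M F (dual_endo M F \<xi>) = \<xi>"
  using assms by (intro one_forms_eqI dual_one_form) (simp_all add: dual_apply dual_one_form F_closed F_F)

lemma dual_flat:
  assumes "X \<in> vector_fields M"
  shows "dual_endo M F (flat M g X) = sec_scale (\<lambda>_. \<epsilon>) (flat M g (F X))"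
proof (rule one_forms_eqI)
  fix Y p assume Y: "Y \<in> vector_fields M" and p: "p \<in> points M"
  have "dual_endo M F (flat M g X) p (Y p) = g p (X p) (F Y p)"
    using assms Y p by (simp add: dual_apply flat_one_form flat_apply vector_field_tangent F_closed)
  also have "\<dots> = \<epsilon> * g p (F X p) (Y p)"
    unfolding g_F[OF assms Y p] using eps_square by (simp add: mult.assoc[symmetric])
  finally show "dual_endo M F (flat M g X) p (Y p) = sec_scale (\<lambda>_. \<epsilon>) (flat M g (F X)) p (Y p)"
    by (simp add: sec_scale_def flat_apply p vector_field_tangent[OF Y])
qed (use assms in \<open>simp_all add: dual_one_form flat_one_form sec_scale_one_form F_closed
  smooth_scalar_const\<close>)

text \<open>The relation \<open>dual_flat\<close>, taken at \<open>sharp M g \<xi>\<close> and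
  carried back by \<open>sharp\<close>.\<close>

lemma sharp_dual:
  assumes "\<xi> \<in> one_forms M"
  shows "sharp M g (dual_endo M F \<xi>) = sec_scale (\<lambda>_. \<epsilon>) (F (sharp M g \<xi>))"
proof -
  let ?X = "F (sharp M g \<xi>)"
  have X: "?X \<in> vector_fields M"
    using assms by (simp add: F_closed sharp_vector_field)
  have "dual_endo M F \<xi> = flat M g (sec_scale (\<lambda>_. \<epsilon>) ?X)"
    using dual_flat[OF sharp_vector_field[OF assms]] by (simp add: flat_sharp[OF assms] flat_scale X)
  then show ?thesis
    by (simp add: sharp_flat sec_scale_vector_field[OF smooth_scalar_const X])
qed

abbreviation J :: "('a, 'b) gsec \<Rightarrow> ('a, 'b) gsec" where
  "J \<equiv> J_Fg M \<epsilon> F g"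

lemma J_apply:
  "J (X, \<xi>) = (sec_add (F X) (sec_scale (\<lambda>_. - sqrt 2) (sharp M g \<xi>)),
    sec_add (sec_scale (\<lambda>_. sqrt 2) (flat M g X)) (sec_scale (\<lambda>_. - \<epsilon>) (dual_endo M F \<xi>)))"
  by (simp add: J_Fg_def block_endo_def)

lemma J_closed: "u \<in> gsections M \<Longrightarrow> J u \<in> gsections M"
  by (cases u) (simp add: J_apply gsections_def sec_add_vector_field sec_scale_vector_field
      sec_add_one_form sec_scale_one_form smooth_scalar_const F_closed sharp_vector_field
      flat_one_form dual_one_form)

text \<open>On fields the square is \<open>F F X - 2 X = - X\<close>, on forms
  \<open>- 2 \<xi> + \<epsilon> * \<epsilon> * \<xi> = - \<xi>\<close>. The mixed blocks are
  \<open>sqrt 2\<close> times a difference of two terms that \<open>dual_flat\<close> and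
  \<open>sharp_dual\<close> identify, once more through
  \<open>\<epsilon> * \<epsilon> = 1\<close>.\<close>

lemma J_J:
  assumes X: "X \<in> vector_fields M" and \<xi>: "\<xi> \<in> one_forms M"
  shows "J (J (X, \<xi>)) = gscale (\<lambda>_. -1) (X, \<xi>)"
proof -
  note closed = X \<xi> smooth_scalar_const F_closed sharp_vector_field flat_one_form dual_one_form
    sec_scale_vector_field sec_scale_one_form
  note push = endo_add[OF endo_F] endo_scale[OF endo_F] F_F sharp_add sharp_scale sharp_flat
    flat_add flat_scale flat_sharp dual_add dual_scale dual_dual dual_flat sharp_dual
  have r: "sqrt 2 * (sqrt 2 * a) = 2 * a" "sqrt 2 *\<^sub>R sqrt 2 *\<^sub>R y = 2 *\<^sub>R y"
    for a and y :: 'b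
    by (simp_all add: mult.assoc[symmetric])
  have e: "\<epsilon> * (\<epsilon> * a) = a" "\<epsilon> *\<^sub>R \<epsilon> *\<^sub>R y = y" for a and y :: 'b
    using eps by auto
  show ?thesis
    unfolding J_apply gscale_def
    \<comment> \<open>All operators are first driven down to \<open>X\<close>, \<open>F X\<close>,
      \<open>\<xi>\<close> and \<open>sharp M g \<xi>\<close>; only then are sums and scalings
      unfolded, leaving an identity between scalar multiples.\<close>
    by (simp add: closed push)
      (auto simp: sec_add_def sec_scale_def fun_eq_iff r e scaleR_2 algebra_simps)
qed

lemma gen_almost_complex_J: "gen_almost_complex M J"
  unfolding gen_almost_complex_def module_endomorphism_def
proof (intro conjI ballI)
  fix u assume u: "u \<in> gsections M"
  then obtain X \<xi> where u_eq: "u = (X, \<xi>)" and X: "X \<in> vector_fields M" and \<xi>: "\<xi> \<in> one_forms M"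
    by (auto simp: gsections_def)
  show "J u \<in> gsections M"
    by (rule J_closed[OF u])
  show "J (J u) = gscale (\<lambda>_. -1) u"
    unfolding u_eq by (rule J_J[OF X \<xi>])
  show "J (gadd u v) = gadd (J u) (J v)" if v: "v \<in> gsections M" for v
  proof -
    obtain Y \<eta> where v_eq: "v = (Y, \<eta>)" and Y: "Y \<in> vector_fields M" and \<eta>: "\<eta> \<in> one_forms M"
      using v by (auto simp: gsections_def)
    show ?thesis
      unfolding u_eq v_eq gadd_def fst_conv snd_conv J_apply
        endo_add[OF endo_F X Y] sharp_add[OF \<xi> \<eta>] flat_add[OF X Y] dual_add[OF \<xi> \<eta>]
      by (simp add: sec_add_def sec_scale_def fun_eq_iff algebra_simps)
  qed
  show "J (gscale f u) = gscale f (J u)" if "f \<in> smooth_functions M" for f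
  proof -
    note f = smooth_scalar_smooth_function[OF that]
    show ?thesis
      unfolding u_eq gscale_def fst_conv snd_conv J_apply
        endo_scale[OF endo_F f X] sharp_scale[OF f \<xi>] flat_scale[OF X] dual_scale[OF f \<xi>]
      by (simp add: sec_add_def sec_scale_def fun_eq_iff algebra_simps)
  qed
qed

section \<open>The natural metric evaluated on images of \<open>J\<close>\<close>

lemma snd_J_apply:
  assumes X: "X \<in> vector_fields M" and \<xi>: "\<xi> \<in> one_forms M" and Y: "Y \<in> vector_fields M"
    and p: "p \<in> points M"
  shows "snd (J (X, \<xi>)) p (Y p) = sqrt 2 * g p (X p) (Y p) - \<epsilon> * \<xi> p (F Y p)"
  by (simp add: J_apply sec_add_def sec_scale_def flat_apply[OF p vector_field_tangent[OF Y]]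
      dual_apply[OF \<xi> Y p])

lemma fst_J:
  "fst (J (X, \<xi>)) p = (\<lambda>k. F X p k + (- sqrt 2) *\<^sub>R sharp M g \<xi> p k)"
  by (simp add: J_apply sec_add_def sec_scale_def)

lemma one_form_fst_J:
  assumes X: "X \<in> vector_fields M" and \<xi>: "\<xi> \<in> one_forms M" and \<eta>: "\<eta> \<in> one_forms M"
    and p: "p \<in> points M"
  shows "\<eta> p (fst (J (X, \<xi>)) p) = \<eta> p (F X p) - sqrt 2 * \<eta> p (sharp M g \<xi> p)"
proof -
  have s: "sharp M g \<xi> p \<in> tangent_space M p"
    by (rule vector_field_tangent[OF sharp_vector_field[OF \<xi>]])
  show ?thesis
    by (simp only: fst_J one_form_add[OF \<eta> vector_field_tangent[OF F_closed[OF X]] tangent_scale[OF s]]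
        one_form_scale[OF \<eta> s])
qed

text \<open>The coefficient -2 comes from pairing the two musical blocks, since
  \<open>g (X, sharp \<eta>) = \<eta> X\<close>; the coefficient \<open>- \<epsilon>\<close> comes
  from pairing the two diagonal blocks, where \<open>F\<close> meets its transpose and squares to
  the identity.\<close>

lemma snd_J_fst_J:
  assumes X: "X \<in> vector_fields M" and \<xi>: "\<xi> \<in> one_forms M"
    and Y: "Y \<in> vector_fields M" and \<eta>: "\<eta> \<in> one_forms M" and p: "p \<in> points M"
  shows "snd (J (X, \<xi>)) p (fst (J (Y, \<eta>)) p) =
    sqrt 2 * g p (X p) (F Y p) - 2 * \<eta> p (X p) - \<epsilon> * \<xi> p (Y p)
    + \<epsilon> * sqrt 2 * \<xi> p (F (sharp M g \<eta>) p)"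
proof -
  have "J (X, \<xi>) \<in> gsections M"
    using X \<xi> by (intro J_closed) (simp add: gsections_def)
  then have s: "snd (J (X, \<xi>)) \<in> one_forms M"
    by (auto simp: gsections_def)
  note S = sharp_vector_field[OF \<eta>]
  have "snd (J (X, \<xi>)) p (fst (J (Y, \<eta>)) p) =
      snd (J (X, \<xi>)) p (F Y p) - sqrt 2 * snd (J (X, \<xi>)) p (sharp M g \<eta> p)"
    by (rule one_form_fst_J[OF Y \<eta> s p])
  also have "\<dots> = sqrt 2 * g p (X p) (F Y p) - \<epsilon> * \<xi> p (Y p)
      - sqrt 2 * (sqrt 2 * \<eta> p (X p) - \<epsilon> * \<xi> p (F (sharp M g \<eta>) p))"
    unfolding snd_J_apply[OF X \<xi> F_closed[OF Y] p] snd_J_apply[OF X \<xi> S p] F_F[OF Y]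
    using g_commute[OF p vector_field_tangent[OF X] vector_field_tangent[OF S]]
      g_sharp[OF \<eta> p vector_field_tangent[OF X]] by simp
  also have "sqrt 2 * (sqrt 2 * \<eta> p (X p) - \<epsilon> * \<xi> p (F (sharp M g \<eta>) p)) =
      2 * \<eta> p (X p) - \<epsilon> * sqrt 2 * \<xi> p (F (sharp M g \<eta>) p)"
    by (simp add: right_diff_distrib mult.assoc[symmetric] mult.commute[of \<epsilon>])
  finally show ?thesis
    by simp
qed

text \<open>The two cross terms are \<open>\<epsilon>\<close>-symmetric and hence cancel exactly for \<open>\<epsilon> = -1\<close>.\<close>

lemma natural_metric_J:
  assumes X: "X \<in> vector_fields M" and \<xi>: "\<xi> \<in> one_forms M"
    and Y: "Y \<in> vector_fields M" and \<eta>: "\<eta> \<in> one_forms M" and p: "p \<in> points M"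
  shows "natural_metric (J (X, \<xi>)) (J (Y, \<eta>)) p =
    (1 + \<epsilon>) * sqrt 2 / 2 * (g p (Y p) (F X p) + \<epsilon> * \<xi> p (F (sharp M g \<eta>) p))
    - (2 + \<epsilon>) * natural_metric (X, \<xi>) (Y, \<eta>) p"
proof -
  note SX = sharp_vector_field[OF \<xi>] and SY = sharp_vector_field[OF \<eta>]
  note t = vector_field_tangent
  have 1: "g p (X p) (F Y p) = \<epsilon> * g p (Y p) (F X p)"
    using g_F[OF Y X p] g_commute[OF p t[OF X] t[OF F_closed[OF Y]]] by simp
  \<comment> \<open>The symmetry of the preceding fact, now for forms: both are turned into fields
    by \<open>sharp\<close>, \<open>F\<close> is moved across \<open>g\<close>, and the result is
    read back as a pairing.\<close>
  have "\<eta> p (F (sharp M g \<xi>) p) = g p (sharp M g \<eta> p) (F (sharp M g \<xi>) p)"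
    using g_sharp[OF \<eta> p t[OF F_closed[OF SX]]] by simp
  also have "\<dots> = g p (F (sharp M g \<xi>) p) (sharp M g \<eta> p)"
    by (rule g_commute[OF p t[OF SY] t[OF F_closed[OF SX]]])
  also have "\<dots> = \<epsilon> * g p (sharp M g \<xi> p) (F (sharp M g \<eta>) p)"
    by (rule g_F[OF SX SY p])
  also have "\<dots> = \<epsilon> * \<xi> p (F (sharp M g \<eta>) p)"
    using g_sharp[OF \<xi> p t[OF F_closed[OF SY]]] by simp
  finally have 2: "\<eta> p (F (sharp M g \<xi>) p) = \<epsilon> * \<xi> p (F (sharp M g \<eta>) p)" .
  show ?thesis
    unfolding natural_metric_def snd_J_fst_J[OF X \<xi> Y \<eta> p] snd_J_fst_J[OF Y \<eta> X \<xi> p] 1 2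
    using eps by (auto simp: field_simps)
qed

lemma natural_metric_J_norden:
  assumes "\<epsilon> = -1" "u \<in> gsections M" "v \<in> gsections M" "p \<in> points M"
  shows "natural_metric (J u) (J v) p = - natural_metric u v p"
proof -
  obtain X \<xi> Y \<eta> where "u = (X, \<xi>)" "X \<in> vector_fields M" "\<xi> \<in> one_forms M"
    "v = (Y, \<eta>)" "Y \<in> vector_fields M" "\<eta> \<in> one_forms M"
    using assms(2,3) by (auto simp: gsections_def)
  then show ?thesis
    using natural_metric_J[of X \<xi> Y \<eta> p] assms(1,4) by simp
qed

lemma compatible_imp_eps:
  assumes "points M \<noteq> {}" "compatible M J natural_metric"
  shows "\<epsilon> = -1"
proof -
  obtain p where p: "p \<in> points M"
    using assms(1) by blast
  obtain X Y where X: "X \<in> vector_fields M" and Y: "Y \<in> vector_fields M"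
    and nz: "g p (X p) (Y p) \<noteq> 0"
    using g_nonzero[OF p] by metis
  obtain \<delta> where \<delta>: "\<delta> = 1 \<or> \<delta> = -1" and
    comp: "\<And>u v. u \<in> gsections M \<Longrightarrow> v \<in> gsections M \<Longrightarrow>
      natural_metric (J u) (J v) p = \<delta> * natural_metric u v p"
    using assms(2) p unfolding compatible_def by blast
  \<comment> \<open>A pure field against a pure form: every mixed term contains a zero entry, so
    only the multiple \<open>- (2 + \<epsilon>)\<close> of the metric survives, while the metric
    itself is half of \<open>g p (Y p) (X p)\<close>.\<close>
  let ?u = "(X, \<lambda>_ _. 0)" and ?v = "(\<lambda>_ _. 0, flat M g Y)"
  have "g p (\<lambda>_. 0) (F X p) = 0"
    using g_scale_left[OF p vector_field_tangent[OF F_closed[OF X]] tangent_0, of 0] by simp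
  then have "natural_metric (J ?u) (J ?v) p = - ((2 + \<epsilon>) * natural_metric ?u ?v p)"
    using natural_metric_J[OF X zero_one_form zero_vector_field flat_one_form[OF Y] p] by simp
  moreover have "natural_metric (J ?u) (J ?v) p = \<delta> * natural_metric ?u ?v p"
    using X Y by (intro comp) (simp_all add: gsections_def zero_one_form zero_vector_field flat_one_form)
  \<comment> \<open>With both signs in {1, -1}, the sum \<open>2 + \<epsilon> + \<delta>\<close>
    vanishes only when both are -1.\<close>
  ultimately have "(2 + \<epsilon> + \<delta>) * natural_metric ?u ?v p = 0"
    by (simp add: algebra_simps)
  moreover have "natural_metric ?u ?v p \<noteq> 0"
    using nz g_commute[OF p vector_field_tangent[OF X] vector_field_tangent[OF Y]]
    by (simp add: natural_metric_def flat_apply p vector_field_tangent[OF X])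
  ultimately show ?thesis
    using \<delta> eps by auto
qed

lemma compatible_iff: "points M \<noteq> {} \<Longrightarrow> compatible M J natural_metric \<longleftrightarrow> \<epsilon> = -1"
  using compatible_imp_eps natural_metric_J_norden unfolding compatible_def by force

text \<open>For \<open>\<epsilon> = -1\<close> the lower diagonal block is the transpose of
  \<open>F\<close> with sign +1. The diagonal blocks therefore contribute the pairings of
  \<open>\<xi>\<close> with \<open>F Y\<close> and of \<open>\<eta>\<close> with \<open>F X\<close>,
  which form the first summand; the musical blocks contribute the two \<open>g\<close> terms, their
  opposite signs being those of the blocks.\<close>

lemma twin_metric_J:
  assumes "\<epsilon> = -1" and X: "X \<in> vector_fields M" and \<xi>: "\<xi> \<in> one_forms M"
    and Y: "Y \<in> vector_fields M" and \<eta>: "\<eta> \<in> one_forms M" and p: "p \<in> points M"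
  shows "twin_metric J natural_metric (X, \<xi>) (Y, \<eta>) p =
    natural_metric (F X, \<xi>) (F Y, \<eta>) p +
    sqrt 2 / 2 * (g p (X p) (Y p) - g p (sharp M g \<xi> p) (sharp M g \<eta> p))"
proof -
  note t = vector_field_tangent[OF sharp_vector_field]
  have "\<eta> p (sharp M g \<xi> p) = g p (sharp M g \<xi> p) (sharp M g \<eta> p)"
    using g_sharp[OF \<eta> p t[OF \<xi>]] g_commute[OF p t[OF \<xi>] t[OF \<eta>]] by simp
  moreover have "snd (J (X, \<xi>)) p (Y p) = sqrt 2 * g p (X p) (Y p) + \<xi> p (F Y p)"
    using snd_J_apply[OF X \<xi> Y p] assms(1) by simp
  ultimately show ?thesis
    using one_form_fst_J[OF X \<xi> \<eta> p]
    by (simp add: twin_metric_def natural_metric_def field_simps)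
qed

end

section \<open>Passage from metric manifolds to the setting above, and conclusion\<close>

lemma riemannian_nondegenerate: "riemannian_metric M g \<Longrightarrow> nondegenerate M g"
  unfolding riemannian_metric_def positive_definite_def nondegenerate_def
  by (metis less_irrefl)

lemma metric_manifold_almost_product:
  assumes "metric_manifold 1 \<epsilon> M F g"
  shows "almost_product_mfd M g F \<epsilon>"
proof -
  have "smooth_manifold M" "symmetric_2tensor M g" "nondegenerate M g"
    using assms riemannian_nondegenerate
    by (auto simp: metric_manifold_def riemannian_metric_def pseudo_riemannian_metric_def)
  moreover have "sec_scale (\<lambda>_. 1) X = X" for X :: "('a, 'b) vfield"
    by (simp add: sec_scale_def)
  ultimately show ?thesis
    using assms unfolding metric_manifold_def
    by unfold_locales auto
qed

theorem proposition4p12: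
  fixes M :: "('m, 'e::euclidean_space) mfd"
    and F :: "('m, 'e) vfield \<Rightarrow> ('m, 'e) vfield"
    and g :: "('m, 'e) tensor2"
    and \<epsilon> :: real
  assumes "points M \<noteq> {}"
    and "metric_manifold 1 \<epsilon> M F g"
  shows "gen_almost_complex M (J_Fg M \<epsilon> F g) \<and>
    (compatible M (J_Fg M \<epsilon> F g) natural_metric \<longleftrightarrow> \<epsilon> = -1) \<and>
    (compatible M (J_Fg M \<epsilon> F g) natural_metric \<longleftrightarrow> almost_para_hermitian M F g) \<and>
    (\<epsilon> = -1 \<longrightarrow>
       gen_almost_norden M (J_Fg M \<epsilon> F g) natural_metric \<and>
       (\<forall>X\<in>vector_fields M. \<forall>Y\<in>vector_fields M. \<forall>\<xi>\<in>one_forms M. \<forall>\<eta>\<in>one_forms M. \<forall>p\<in>points M.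
          twin_metric (J_Fg M \<epsilon> F g) natural_metric (X, \<xi>) (Y, \<eta>) p =
            natural_metric (F X, \<xi>) (F Y, \<eta>) p +
            sqrt 2 / 2 * (g p (X p) (Y p) - g p (sharp M g \<xi> p) (sharp M g \<eta> p))))"
proof -
  interpret almost_product_mfd M g F \<epsilon>
    by (rule metric_manifold_almost_product[OF assms(2)])
  note iff = compatible_iff[OF assms(1)]
  have herm: "\<epsilon> = -1 \<longleftrightarrow> almost_para_hermitian M F g"
  proof
    assume "almost_para_hermitian M F g"
    \<comment> \<open>The same \<open>F\<close> and \<open>g\<close> now satisfy the compatibility
      law with two constants, \<open>\<epsilon>\<close> and -1; a single nonzero value of
      \<open>g\<close> shows that they agree.\<close>
    then interpret H: almost_product_mfd M g F "-1"
      unfolding almost_para_hermitian_def by (rule metric_manifold_almost_product)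
    obtain p where p: "p \<in> points M"
      using assms(1) by blast
    obtain X Y where XY: "X \<in> vector_fields M" "Y \<in> vector_fields M" "g p (X p) (Y p) \<noteq> 0"
      using g_nonzero[OF p] by metis
    have "\<epsilon> * g p (X p) (Y p) = -1 * g p (X p) (Y p)"
      using g_F_F[OF XY(1,2) p] H.g_F_F[OF XY(1,2) p] by simp
    then show "\<epsilon> = -1"
      using XY(3) unfolding mult_cancel_right by blast
  qed (use assms(2) in \<open>simp add: almost_para_hermitian_def\<close>)
  have "gen_almost_norden M J natural_metric" if "\<epsilon> = -1"
    unfolding gen_almost_norden_def
    using gen_almost_complex_J gen_metric_natural natural_metric_J_norden[OF that] by blast
  then show ?thesis
    using gen_almost_complex_J iff herm twin_metric_J by blast
qed

end
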